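(* Let $m\in(0,|B_1|)$, and let $j\in C^1(\mathbb{R}_+)$ be a non-constant, non-decreasing, convex function. Then there exist $\bar\delta>0$ and a positive constant $C=C(j,m,n)$ such that for every $\delta\in(0,\bar\delta)$, $$\frac{1}{C}\,\delta^2\le\mathcal{J}(B_* )-\mathcal{J}(A_\delta)\le C\,\delta^2.$$
   Context: $\mathbb{R}_+=[0,+\infty)$; $B_1$ is the open unit ball of $\mathbb{R}^n$ ($n\ge1$) centered at the origin, $B_r$ is the open ball of radius $r$ centered at the origin, $|\cdot|$ on sets denotes Lebesgue measure. For a measurable set $E\subset B_1$, $u_E\in H^1_0(B_1)$ is the unique weak solution of $-\Delta u_E=\chi_E$ in $B_1$, $u_E=0$ on $\partial B_1$, and $\mathcal{J}(E):=\int_{B_1}j(u_E(x))\,dx$. $B_*$ is the ball centered at the origin with $|B_*|=m$, and $r_*$ is its radius. For $\delta\in(0,\min\{2m,2(|B_1|-m)\})$, $$A_\delta=B_{r_1(\delta)}\cup\{x\in\mathbb{R}^n: r_*<|x|<r_2(\delta)\},\quad r_1(\delta)=\frac{(m-\delta/2)^{1/n}}{|B_1|^{1/n}},\quad r_2(\delta)=\frac{(m+\delta/2)^{1/n}}{|B_1|^{1/n}},$$ so that $|A_\delta|=m$ and $|A_\delta\Delta B_*|=\delta$.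
   Formalization: "Non-constant" is strengthened: j(u_{B_*}) must not be a.e. constant on B_1. Without this the claim fails, e.g. for j(t)=max(0,t-1)^2, since u_E≤1/2 makes both functionals 0; the condition is also necessary for the lower bound. *)

theory Defs
  imports "HOL-Analysis.Analysis"
begin

section \<open>Test functions\<close>

primrec Ck :: "nat \<Rightarrow> ('a::euclidean_space \<Rightarrow> real) \<Rightarrow> bool" where
  "Ck 0 f \<longleftrightarrow> continuous_on UNIV f"
| "Ck (Suc k) f \<longleftrightarrow>
     (\<forall>x. f differentiable (at x)) \<and>
     (\<forall>i\<in>Basis. Ck k (\<lambda>x. frechet_derivative f (at x) i))"

definition gradient :: "('a::euclidean_space \<Rightarrow> real) \<Rightarrow> 'a \<Rightarrow> 'a" where
  "gradient f x = (\<Sum>i\<in>Basis. frechet_derivative f (at x) i *\<^sub>R i)"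

definition test_function :: "'a::euclidean_space set \<Rightarrow> ('a \<Rightarrow> real) \<Rightarrow> bool" where
  "test_function \<Omega> \<phi> \<longleftrightarrow>
     (\<forall>k. Ck k \<phi>) \<and> compact (closure {x. \<phi> x \<noteq> 0}) \<and> closure {x. \<phi> x \<noteq> 0} \<subseteq> \<Omega>"


section \<open>Sobolev spaces\<close>

definition square_integrable ::
    "'a::euclidean_space set \<Rightarrow> ('a \<Rightarrow> 'b::euclidean_space) \<Rightarrow> bool" where
  "square_integrable \<Omega> f \<longleftrightarrow>
     f \<in> borel_measurable (lebesgue_on \<Omega>) \<and> integrable (lebesgue_on \<Omega>) (\<lambda>x. (norm (f x))\<^sup>2)"

definition weak_gradient ::
    "'a::euclidean_space set \<Rightarrow> ('a \<Rightarrow> real) \<Rightarrow> ('a \<Rightarrow> 'a) \<Rightarrow> bool" where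
  "weak_gradient \<Omega> u g \<longleftrightarrow>
     (\<forall>\<phi>. test_function \<Omega> \<phi> \<longrightarrow> (\<forall>i\<in>Basis.
        (LINT x|lebesgue_on \<Omega>. u x * (gradient \<phi> x \<bullet> i)) =
        - (LINT x|lebesgue_on \<Omega>. (g x \<bullet> i) * \<phi> x)))"

text \<open>
  Sobolev functions are represented together with their weak gradient, which is determined
  by the function up to a null set: the two predicates below say that \<open>u\<close> belongs to the
  space and that \<open>g\<close> is a weak gradient of \<open>u\<close>.
\<close>

definition H1 :: "'a::euclidean_space set \<Rightarrow> ('a \<Rightarrow> real) \<Rightarrow> ('a \<Rightarrow> 'a) \<Rightarrow> bool" where
  "H1 \<Omega> u g \<longleftrightarrow> square_integrable \<Omega> u \<and> square_integrable \<Omega> g \<and> weak_gradient \<Omega> u g"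

text \<open>The closure of the test functions with respect to the norm of \<open>H1\<close>.\<close>

definition H10 :: "'a::euclidean_space set \<Rightarrow> ('a \<Rightarrow> real) \<Rightarrow> ('a \<Rightarrow> 'a) \<Rightarrow> bool" where
  "H10 \<Omega> u g \<longleftrightarrow> H1 \<Omega> u g \<and>
     (\<exists>\<phi> :: nat \<Rightarrow> 'a \<Rightarrow> real. (\<forall>k. test_function \<Omega> (\<phi> k)) \<and>
        (\<lambda>k. LINT x|lebesgue_on \<Omega>. (u x - \<phi> k x)\<^sup>2 + (norm (g x - gradient (\<phi> k) x))\<^sup>2)
          \<longlonglongrightarrow> 0)"


section \<open>The Dirichlet problem and the functional\<close>

text \<open>\<open>u\<close> solves \<open>- \<Delta> u = f\<close> weakly in \<open>\<Omega>\<close> with zero boundary values.\<close>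

definition weak_solution ::
    "'a::euclidean_space set \<Rightarrow> ('a \<Rightarrow> real) \<Rightarrow> ('a \<Rightarrow> real) \<Rightarrow> bool" where
  "weak_solution \<Omega> f u \<longleftrightarrow>
     (\<exists>g. H10 \<Omega> u g \<and>
        (\<forall>v h. H10 \<Omega> v h \<longrightarrow>
           (LINT x|lebesgue_on \<Omega>. g x \<bullet> h x) = (LINT x|lebesgue_on \<Omega>. f x * v x)))"

text \<open>
  As an element of \<open>H10\<close> the weak solution is unique only up to null sets, so \<open>SOME\<close>
  selects a representative.
\<close>

definition torsion :: "'a::euclidean_space set \<Rightarrow> 'a \<Rightarrow> real" where
  "torsion E = (SOME u. weak_solution (ball 0 1) (indicator E) u)"

definition J_functional :: "(real \<Rightarrow> real) \<Rightarrow> 'a::euclidean_space set \<Rightarrow> real" where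
  "J_functional j E = (LINT x|lebesgue_on (ball 0 1). j (torsion E x))"

definition C1_on_halfline :: "(real \<Rightarrow> real) \<Rightarrow> bool" where
  "C1_on_halfline j \<longleftrightarrow>
     (\<exists>j'. continuous_on {0..} j' \<and>
        (\<forall>t\<ge>0. (j has_real_derivative j' t) (at t within {0..})))"


section \<open>The perturbed balls\<close>

abbreviation unit_ball_volume :: "'a::euclidean_space itself \<Rightarrow> real" where
  "unit_ball_volume T \<equiv> measure lebesgue (ball (0::'a) 1)"

text \<open>
  Here \<open>rs\<close> is the radius of the ball of volume \<open>m\<close>. All bases of \<open>powr\<close> are positive
  for the admissible \<open>\<delta>\<close>.
\<close>

definition A_set :: "real \<Rightarrow> real \<Rightarrow> real \<Rightarrow> 'a::euclidean_space set" where
  "A_set m rs \<delta> =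
     (let n = real DIM('a);
          \<omega> = unit_ball_volume TYPE('a);
          r1 = (m - \<delta> / 2) powr (1 / n) / \<omega> powr (1 / n);
          r2 = (m + \<delta> / 2) powr (1 / n) / \<omega> powr (1 / n)
      in ball 0 r1 \<union> {x. rs < norm x \<and> norm x < r2})"

text \<open>
  The functional only sees the values of \<open>j\<close> on the range of the torsion functions. If \<open>j\<close> is
  non-constant on the half-line but constant on the range of \<open>torsion B\<close>, where \<open>B\<close> is the ball
  of volume \<open>m\<close> (for example \<open>j t = (max 0 (t - 1))\<^sup>2\<close>, as torsion functions are at most
  \<open>1/2\<close>), then the functional has the same value at \<open>B\<close> and at every perturbed ball, and no
  quadratic lower bound can hold. The condition below excludes this case.
\<close>

definition nonconstant_along :: "(real \<Rightarrow> real) \<Rightarrow> 'a::euclidean_space set \<Rightarrow> bool" where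
  "nonconstant_along j E \<longleftrightarrow> \<not> (\<exists>c. AE x in lebesgue_on (ball 0 1). j (torsion E x) = c)"

end

theory Submission
  imports Defs
begin

text \<open>
  Let \<open>\<omega>\<close> be the volume of the unit ball, \<open>B = m / \<omega>\<close> and \<open>e = \<delta> / (2 * \<omega>)\<close>. For a radial set \<open>E\<close> the
  torsion function is a function of \<open>s = x \<bullet> x\<close>, and by the divergence theorem its gradient is
  \<open>- W s *\<^sub>R x\<close>, where \<open>n * W s\<close> is the fraction of the ball of radius \<open>sqrt s\<close> that \<open>E\<close> occupies. For
  a centred ball which fills the fraction \<open>B\<close> of the unit ball, this fraction is \<open>min y B / y\<close> with
  \<open>y = s powr (n / 2)\<close>.

  Up to a null set, the indicator of the perturbed ball is the sum of the indicators of the centred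
  balls of fractions \<open>B - e\<close> and \<open>B + e\<close>, minus the one of fraction \<open>B\<close>. The equation being linear, the
  difference \<open>D\<close> of the torsion functions of the ball and of the perturbed ball is the negative of a
  second difference with respect to \<open>B\<close>, and
  \<open>D' s = - max 0 (e - \<bar>y - B\<bar>) / (2 * n * y)\<close>. This is a tent whose height and width are both
  of order \<open>e\<close>, so that \<open>D\<close> is non-negative, at most \<open>K * e\<^sup>2\<close> everywhere, and at least \<open>k * e\<^sup>2\<close> near the
  centre (\<open>profile_deficit_bounds\<close>).

  The functional turns these pointwise bounds into the claim. The slopes of the convex function \<open>j\<close> are
  bounded on the range of the torsion functions, which gives the upper bound. For the lower bound, the
  integrand \<open>j u - j (u - D)\<close> is non-negative by monotonicity. Since \<open>j\<close> is not constant on the range of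
  \<open>u\<close>, it has positive slope from some value below the maximum of \<open>u\<close> on, and therefore on a small ball
  around the origin the integrand is at least a multiple of \<open>e\<^sup>2\<close>.

  What remains is to identify the torsion functions with these explicit profiles. The profiles
  belong to \<open>H10\<close>, since they are limits of polynomials in \<open>x \<bullet> x\<close> multiplied by smooth cutoffs
  (\<open>H10_radial\<close>). They solve the equation by \<open>integration_by_parts\<close>, which rests on the translation
  invariance of Lebesgue measure. The solution is
  unique by the Poincare inequality (\<open>weak_solution_unique\<close>).
\<close>

section \<open>Smooth functions\<close>

lemma Ck_SucI:
  assumes "\<And>x. (f has_derivative f' x) (at x)" "\<And>i. i \<in> Basis \<Longrightarrow> Ck k (\<lambda>x. f' x i)"
  shows "Ck (Suc k) f"
proof -
  have "frechet_derivative f (at x) = f' x" for x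
    using frechet_derivative_at[OF assms(1)] by simp
  then show ?thesis
    using assms by (auto simp: differentiable_def)
qed

lemma Ck_Suc_imp_Ck: "Ck (Suc k) f \<Longrightarrow> Ck k f"
proof (induction k arbitrary: f)
  case 0
  then have "\<forall>x. f differentiable (at x)" by simp
  then show ?case
    by (simp add: continuous_on_eq_continuous_at differentiable_imp_continuous_within)
next
  case (Suc k)
  have d: "\<forall>x. f differentiable (at x)"
    and c: "\<forall>i\<in>Basis. Ck (Suc k) (\<lambda>x. frechet_derivative f (at x) i)"
    using Suc.prems unfolding Ck.simps(2)[of "Suc k"] by blast+
  show ?case
    using d c Suc.IH by (subst Ck.simps) blast
qed

lemma Ck_imp_continuous: "Ck k f \<Longrightarrow> continuous_on UNIV f"
  by (induction k) (use Ck_Suc_imp_Ck in auto)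

lemma Ck_const: "Ck k (\<lambda>x::'a::euclidean_space. c)"
proof (induction k arbitrary: c)
  case (Suc k)
  show ?case by (rule Ck_SucI[OF has_derivative_const]) (rule Suc)
qed simp

lemma Ck_linear: "bounded_linear f \<Longrightarrow> Ck k f"
proof (cases k)
  case (Suc l)
  show "bounded_linear f \<Longrightarrow> Ck k f"
    unfolding Suc by (rule Ck_SucI[OF bounded_linear_imp_has_derivative]) (auto intro: Ck_const)
qed (simp add: linear_continuous_on)

lemma Ck_add:
  assumes "Ck k f" "Ck k g" shows "Ck k (\<lambda>x. f x + g x)"
  using assms
proof (induction k arbitrary: f g)
  case 0 then show ?case by (simp add: continuous_on_add)
next
  case (Suc k)
  show ?case
  proof (rule Ck_SucI)
    fix x show "((\<lambda>x. f x + g x) has_derivative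
       (\<lambda>h. frechet_derivative f (at x) h + frechet_derivative g (at x) h)) (at x)"
      using Suc.prems by (auto intro!: has_derivative_add simp: frechet_derivative_works)
  qed (use Suc in auto)
qed

lemma Ck_mult:
  assumes "Ck k f" "Ck k g" shows "Ck k (\<lambda>x. f x * g x)"
  using assms
proof (induction k arbitrary: f g)
  case 0 then show ?case by (simp add: continuous_on_mult)
next
  case (Suc k)
  show ?case
  proof (rule Ck_SucI)
    fix x show "((\<lambda>x. f x * g x) has_derivative
       (\<lambda>h. f x * frechet_derivative g (at x) h + frechet_derivative f (at x) h * g x)) (at x)"
      using Suc.prems by (auto intro!: has_derivative_mult simp: frechet_derivative_works)
  next
    fix i :: 'a assume i: "i \<in> Basis"
    have "Ck k f" "Ck k g" using Suc.prems Ck_Suc_imp_Ck by blast+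
    then show "Ck k (\<lambda>x. f x * frechet_derivative g (at x) i + frechet_derivative f (at x) i * g x)"
      using Suc i by (intro Ck_add Suc.IH) auto
  qed
qed

lemma Ck_diff: "Ck k f \<Longrightarrow> Ck k g \<Longrightarrow> Ck k (\<lambda>x. f x - g x)"
  using Ck_add[of k f "\<lambda>x. (-1) * g x"] Ck_mult[OF Ck_const[of k "-1"], of g] by simp

lemma Ck_power: "Ck k f \<Longrightarrow> Ck k (\<lambda>x. f x ^ n)"
  by (induction n) (auto intro: Ck_const Ck_mult)

lemma Ck_sum: "finite A \<Longrightarrow> (\<And>i. i \<in> A \<Longrightarrow> Ck k (f i)) \<Longrightarrow> Ck k (\<lambda>x. \<Sum>i\<in>A. f i x)"
  by (induction A rule: finite_induct) (auto intro: Ck_const Ck_add)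

lemma Ck_real_SucI:
  assumes "\<And>x. (f has_real_derivative f' x) (at x)" "Ck k f'"
  shows "Ck (Suc k) f"
  using assms by (intro Ck_SucI[where f' = "\<lambda>x. (*) (f' x)"]) (auto simp: has_field_derivative_def)

lemma Ck_real_SucD:
  fixes f :: "real \<Rightarrow> real"
  assumes "Ck (Suc k) f"
  obtains f' where "\<And>x. (f has_real_derivative f' x) (at x)" "Ck k f'"
proof
  let ?f' = "\<lambda>x. frechet_derivative f (at x) 1"
  show "Ck k ?f'" using assms by simp
  fix x 
  have "(f has_derivative frechet_derivative f (at x)) (at x)"
    using assms by (simp add: frechet_derivative_works)
  moreover from this have "frechet_derivative f (at x) = (*) (?f' x)"
  proof -
    assume "(f has_derivative frechet_derivative f (at x)) (at x)"
    then have "linear (frechet_derivative f (at x))" by (rule has_derivative_linear)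
    then have "frechet_derivative f (at x) (h *\<^sub>R 1) = h *\<^sub>R ?f' x" for h
      by (rule linear_scale)
    then show ?thesis
      unfolding fun_eq_iff by (metis mult.commute mult.right_neutral real_scaleR_def)
  qed
  ultimately show "(f has_real_derivative ?f' x) (at x)"
    by (simp add: has_field_derivative_def)
qed

lemma has_derivative_inner_self_compose:
  fixes f :: "real \<Rightarrow> real" and x :: "'a::euclidean_space"
  assumes "(f has_real_derivative D) (at (x \<bullet> x))"
  shows "((\<lambda>x. f (x \<bullet> x)) has_derivative (\<lambda>h. 2 * (x \<bullet> h) * D)) (at x)"
proof -
  have "((\<lambda>x. f (x \<bullet> x)) has_derivative (\<lambda>h. D * (x \<bullet> h + h \<bullet> x))) (at x)"
    using assms
    by (intro has_derivative_compose[of "\<lambda>x. x \<bullet> x" _ x UNIV f "(*) D"] has_derivative_inner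
        has_derivative_ident) (auto simp: has_field_derivative_def)
  then show ?thesis
    by (simp add: inner_commute algebra_simps)
qed

text \<open>
  Every partial derivative of \<open>f (x \<bullet> x)\<close> is \<open>2 * (x \<bullet> i) * f' (x \<bullet> x)\<close>, a product of a linear function
  and a function of the same kind, so an induction on \<open>k\<close> over all \<open>f\<close> at once closes up.
\<close>

lemma Ck_radial:
  fixes f :: "real \<Rightarrow> real"
  assumes "Ck k f"
  shows "Ck k (\<lambda>x::'a::euclidean_space. f (x \<bullet> x))"
  using assms
proof (induction k arbitrary: f)
  case 0
  then show ?case
    by (auto intro!: continuous_on_compose2[of UNIV f] continuous_intros)
next
  case (Suc k)
  from Suc.prems obtain f' where f': "\<And>x. (f has_real_derivative f' x) (at x)" "Ck k f'"
    by (rule Ck_real_SucD) blast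
  show ?case
    by (rule Ck_SucI[OF has_derivative_inner_self_compose[OF f'(1)]])
       (intro Ck_mult Ck_const Suc.IH f'(2) Ck_linear bounded_linear_inner_left)
qed

subsection \<open>A smooth cutoff\<close>

text \<open>
  The standard smooth function that vanishes to infinite order at \<open>0\<close>; the cutoffs below are
  \<open>flat_exp\<close> composed with steep affine functions.
\<close>

definition flat_exp :: "real \<Rightarrow> real" where
  "flat_exp t = (if t > 0 then exp (- inverse t) else 0)"

lemma flat_exp_pos: "t > 0 \<Longrightarrow> flat_exp t = exp (- inverse t)"
  and flat_exp_nonpos: "t \<le> 0 \<Longrightarrow> flat_exp t = 0"
  by (auto simp: flat_exp_def)

lemma flat_exp_bounds: "0 \<le> flat_exp t" "flat_exp t \<le> 1"
  by (auto simp: flat_exp_def)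

lemma flat_exp_tendsto_1: "(flat_exp \<longlongrightarrow> 1) at_top"
proof -
  have "((\<lambda>t::real. exp (- inverse t)) \<longlongrightarrow> exp (- 0)) at_top"
    by (intro tendsto_intros tendsto_inverse_0_at_top filterlim_ident)
  then have "((\<lambda>t::real. exp (- inverse t)) \<longlongrightarrow> 1) at_top"
    by simp
  then show ?thesis
    by (rule Lim_transform_eventually)
      (auto intro: eventually_mono[OF eventually_gt_at_top[of 0]] simp: flat_exp_def)
qed

lemma poly_times_flat_exp_over_tendsto_0:
  "((\<lambda>t. poly p (inverse t) * flat_exp t * inverse t) \<longlongrightarrow> 0) (at 0)"
proof -
  have lim: "((\<lambda>y::real. y ^ k / exp y) \<longlongrightarrow> 0) at_top" for k :: nat
    by (rule tendsto_power_div_exp_0)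
  have "((\<lambda>y::real. poly p y / exp y * y) \<longlongrightarrow> 0) at_top"
  proof -
    have "((\<lambda>y. \<Sum>i\<le>degree p. coeff p i * (y ^ Suc i / exp y)) \<longlongrightarrow> (\<Sum>i\<le>degree p. coeff p i * 0)) at_top"
      by (intro tendsto_intros lim)
    then show ?thesis
      by (simp add: poly_altdef sum_divide_distrib sum_distrib_left mult_ac)
  qed
  then have "((\<lambda>t. poly p (inverse t) / exp (inverse t) * inverse t) \<longlongrightarrow> 0) (at_right 0)"
    by (rule filterlim_compose) (rule filterlim_inverse_at_top_right)
  then have "((\<lambda>t. poly p (inverse t) * flat_exp t * inverse t) \<longlongrightarrow> 0) (at_right 0)"
    by (rule Lim_transform_eventually)
      (auto intro: eventually_mono[OF eventually_at_right_less] simp: flat_exp_def exp_minus divide_inverse)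
  moreover have "((\<lambda>t. poly p (inverse t) * flat_exp t * inverse t) \<longlongrightarrow> 0) (at_left 0)"
    by (rule Lim_transform_eventually[OF tendsto_const])
      (auto simp: eventually_at_filter flat_exp_def)
  ultimately show ?thesis
    by (simp add: filterlim_split_at)
qed

text \<open>
  The functions \<open>p (1 / t) * exp (- 1 / t)\<close> with a polynomial \<open>p\<close> are closed under differentiation, the
  derivative at \<open>0\<close> being \<open>0\<close> because the exponential beats every power. This form makes the induction
  in \<open>Ck_poly_times_flat_exp\<close> possible.
\<close>

lemma poly_times_flat_exp_has_derivative:
  "((\<lambda>t. poly p (inverse t) * flat_exp t) has_real_derivative
     poly ([:0, 0, 1:] * (p - pderiv p)) (inverse t) * flat_exp t) (at t)"
proof (cases t "0::real" rule: linorder_cases)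
  case less
  have "((\<lambda>t. poly p (inverse t) * flat_exp t) has_real_derivative 0) (at t)"
    by (rule has_field_derivative_transform_within_open[of "\<lambda>_. 0" _ _ "{..<0}"])
       (use less in \<open>auto simp: flat_exp_def\<close>)
  then show ?thesis using less by (simp add: flat_exp_def)
next
  case equal
  show ?thesis
    using poly_times_flat_exp_over_tendsto_0[of p]
    by (simp add: equal has_field_derivative_iff flat_exp_nonpos divide_inverse)
next
  case greater
  have "((\<lambda>t. poly p (inverse t) * exp (- inverse t)) has_real_derivative
     poly ([:0, 0, 1:] * (p - pderiv p)) (inverse t) * exp (- inverse t)) (at t)"
  proof -
    have i: "(inverse has_real_derivative - (inverse t * inverse t)) (at t)"
      using greater DERIV_inverse[of t] by (simp add: power2_eq_square)
    have "((\<lambda>t. poly p (inverse t)) has_real_derivative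
        poly (pderiv p) (inverse t) * - (inverse t * inverse t)) (at t)"
      by (rule DERIV_chain2[OF poly_DERIV i])
    moreover have "((\<lambda>t. exp (- inverse t)) has_real_derivative
        exp (- inverse t) * - (- (inverse t * inverse t))) (at t)"
      by (rule DERIV_chain2[OF DERIV_exp DERIV_minus[OF i]])
    ultimately show ?thesis
      by (rule DERIV_cong[OF DERIV_mult]) (simp add: algebra_simps)
  qed
  then show ?thesis
    unfolding flat_exp_pos[OF greater]
    by (rule has_field_derivative_transform_within_open[of _ _ _ "{0<..}"])
       (use greater in \<open>auto simp: flat_exp_def\<close>)
qed

lemma Ck_poly_times_flat_exp: "Ck k (\<lambda>t. poly p (inverse t) * flat_exp t)"
proof (induction k arbitrary: p)
  case 0
  show ?case
    unfolding Ck.simps by (rule DERIV_continuous_on[OF poly_times_flat_exp_has_derivative])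
next
  case (Suc k)
  show ?case
    by (rule Ck_real_SucI[OF poly_times_flat_exp_has_derivative Suc])
qed

lemma Ck_flat_exp: "Ck k flat_exp"
  using Ck_poly_times_flat_exp[of k 1] by simp

lemma flat_exp_has_derivative:
  "(flat_exp has_real_derivative (inverse t)\<^sup>2 * flat_exp t) (at t)"
  using poly_times_flat_exp_has_derivative[of 1 t] by (simp add: power2_eq_square mult.assoc)

lemma Ck_affine_compose:
  fixes f :: "real \<Rightarrow> real"
  assumes "Ck k f" shows "Ck k (\<lambda>t. f (a * t + b))"
  using assms
proof (induction k arbitrary: f)
  case 0
  then show ?case by (auto intro!: continuous_on_compose2[of UNIV f] continuous_intros)
next
  case (Suc k)
  from Suc.prems obtain f' where f': "\<And>x. (f has_real_derivative f' x) (at x)" "Ck k f'"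
    by (rule Ck_real_SucD) blast
  have "((\<lambda>t. f (a * t + b)) has_real_derivative f' (a * t + b) * a) (at t)" for t
    by (rule DERIV_chain2[OF f'(1)]) (auto intro!: derivative_eq_intros)
  then show ?case
    by (rule Ck_real_SucI) (intro Ck_mult Ck_const Suc.IH f'(2))
qed

section \<open>Integration by parts against test functions\<close>

lemma gradient_inner:
  "i \<in> Basis \<Longrightarrow> gradient f x \<bullet> i = frechet_derivative f (at x) i"
  unfolding gradient_def
  by (simp add: inner_sum_left inner_Basis if_distrib[of "(*) _"] cong: if_cong)

lemma gradient_inner_derivative:
  assumes "f differentiable (at x)"
  shows "frechet_derivative f (at x) h = gradient f x \<bullet> h"
proof -
  have "linear (frechet_derivative f (at x))"
    using assms by (simp add: frechet_derivative_works has_derivative_linear)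
  then have "frechet_derivative f (at x) h = (\<Sum>i\<in>Basis. (h \<bullet> i) * frechet_derivative f (at x) i)"
    by (subst (1) euclidean_representation[of h, symmetric], simp add: linear_sum linear_scale)
  also have "\<dots> = gradient f x \<bullet> h"
    by (simp add: gradient_def inner_sum_left mult.commute inner_commute[of h])
  finally show ?thesis .
qed

lemma gradientI:
  assumes "(f has_derivative (\<lambda>h. G \<bullet> h)) (at x)"
  shows "gradient f x = G"
  by (rule euclidean_eqI) (simp add: gradient_inner frechet_derivative_at[OF assms, symmetric])

lemma directional_derivative:
  fixes f :: "'a::euclidean_space \<Rightarrow> real"
  assumes "(f has_derivative (\<lambda>h. G \<bullet> h)) (at x)"
  shows "((\<lambda>t. f (x + t *\<^sub>R i)) has_real_derivative G \<bullet> i) (at 0)"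
proof -
  have "((\<lambda>t. f (x + t *\<^sub>R i)) has_derivative (\<lambda>h. G \<bullet> (h *\<^sub>R i))) (at 0)"
    by (rule has_derivative_compose[of "\<lambda>t. x + t *\<^sub>R i" "\<lambda>h. h *\<^sub>R i" 0 UNIV])
      (use assms in \<open>auto intro!: derivative_eq_intros\<close>)
  then show ?thesis
    by (simp add: has_field_derivative_def mult.commute[of _ "G \<bullet> i"])
qed

lemma test_functionD:
  assumes "test_function \<Omega> \<phi>"
  shows "continuous_on UNIV \<phi>" "continuous_on UNIV (gradient \<phi>)"
    "(\<phi> has_derivative (\<lambda>h. gradient \<phi> x \<bullet> h)) (at x)"
    "x \<notin> \<Omega> \<Longrightarrow> \<phi> x = 0" "x \<notin> \<Omega> \<Longrightarrow> gradient \<phi> x = 0"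
proof -
  have C: "Ck k \<phi>" for k using assms by (simp add: test_function_def)
  show "continuous_on UNIV \<phi>" using C[of 0] by simp
  have "Ck 1 \<phi>" by (rule C)
  then have d: "\<phi> differentiable (at y)" 
    and c: "\<And>i. i \<in> Basis \<Longrightarrow> continuous_on UNIV (\<lambda>x. frechet_derivative \<phi> (at x) i)" for y
    by auto
  show "continuous_on UNIV (gradient \<phi>)"
    unfolding gradient_def[abs_def] by (intro continuous_intros c)
  show "(\<phi> has_derivative (\<lambda>h. gradient \<phi> x \<bullet> h)) (at x)"
    using d[of x] unfolding frechet_derivative_works
    by (simp add: gradient_inner_derivative[OF d, abs_def])
  assume x: "x \<notin> \<Omega>"
  let ?K = "closure {x. \<phi> x \<noteq> 0}"
  have K: "?K \<subseteq> \<Omega>" "closed ?K" using assms by (auto simp: test_function_def)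
  with x have xK: "x \<in> - ?K" by auto
  have z: "\<phi> y = 0" if "y \<in> - ?K" for y
    using that closure_subset[of "{x. \<phi> x \<noteq> 0}"] by auto
  show "\<phi> x = 0" by (rule z[OF xK])
  have "(\<phi> has_derivative (\<lambda>_. 0)) (at x)"
    by (rule has_derivative_transform_within_open[OF has_derivative_const open_Compl[OF K(2)] xK])
      (rule z[symmetric])
  then have "frechet_derivative \<phi> (at x) = (\<lambda>_. 0)"
    by (metis frechet_derivative_at)
  then show "gradient \<phi> x = 0" by (simp add: gradient_def)
qed

text \<open>
  The difference quotients of \<open>\<psi>\<close> in the direction \<open>i\<close> have integral \<open>0\<close> by translation invariance. They
  are dominated, since \<open>\<psi>\<close> is Lipschitz with bounded support, and tend to \<open>\<psi>'\<close> almost everywhere.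
  Differentiability almost everywhere suffices, which is what makes the result applicable to vector
  fields with a kink across a sphere.
\<close>

lemma integral_directional_derivative_eq_0:
  fixes \<psi> :: "'a::euclidean_space \<Rightarrow> real"
  assumes cont: "continuous_on UNIV \<psi>" and supp: "\<And>x. norm x > R \<Longrightarrow> \<psi> x = 0"
    and i: "norm i \<le> 1"
    and lip: "\<And>x t. \<bar>t\<bar> \<le> 1 \<Longrightarrow> \<bar>\<psi> (x + t *\<^sub>R i) - \<psi> x\<bar> \<le> L * \<bar>t\<bar>"
    and diff: "AE x in lebesgue. ((\<lambda>t. \<psi> (x + t *\<^sub>R i)) has_real_derivative \<psi>' x) (at 0)"
    and meas: "\<psi>' \<in> borel_measurable lebesgue"
  shows "integrable lebesgue \<psi>'" "integral\<^sup>L lebesgue \<psi>' = 0"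
proof -
  define q where "q k x = (\<psi> (x + inverse (real (Suc k)) *\<^sub>R i) - \<psi> x) * real (Suc k)" for k x
  define w where "w x = L * indicat_real (cball 0 (R + 1)) x" for x :: 'a
  have cb: "\<psi> \<in> borel_measurable borel"
    using cont by (rule borel_measurable_continuous_onI)
  have int: "integrable lborel \<psi>"
  proof -
    have "integrable lborel (\<lambda>x. indicator (cball 0 R) x *\<^sub>R \<psi> x)"
      by (rule borel_integrable_compact) (auto intro: continuous_on_subset[OF cont])
    also have "(\<lambda>x. indicator (cball 0 R) x *\<^sub>R \<psi> x) = \<psi>"
      using supp by (auto simp: indicator_def fun_eq_iff not_le)
    finally show ?thesis .
  qed
  have tr: "integrable lborel (\<lambda>x. \<psi> (x + c))" "(LINT x|lborel. \<psi> (x + c)) = (LINT x|lborel. \<psi> x)" for c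
  proof -
    have "integrable (distr lborel borel ((+) c)) \<psi>" using int by (simp add: lborel_distr_plus)
    then have "integrable lborel (\<lambda>x. \<psi> (c + x))"
      by (subst (asm) integrable_distr_eq) (use cb in auto)
    then show "integrable lborel (\<lambda>x. \<psi> (x + c))" by (simp add: add.commute)
    have "(LINT x|lborel. \<psi> x) = (LINT x|distr lborel borel ((+) c). \<psi> x)" by (simp add: lborel_distr_plus)
    also have "\<dots> = (LINT x|lborel. \<psi> (c + x))"
      by (subst integral_distr) (use cb in auto)
    finally show "(LINT x|lborel. \<psi> (x + c)) = (LINT x|lborel. \<psi> x)" by (simp add: add.commute)
  qed
  have qb: "q k \<in> borel_measurable borel" for k
    unfolding q_def by (intro borel_measurable_continuous_onI continuous_intros
        continuous_on_compose2[OF cont]) auto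
  have q0: "integral\<^sup>L lebesgue (q k) = 0" for k
  proof -
    have "integral\<^sup>L lebesgue (q k) = integral\<^sup>L lborel (q k)"
      using qb by (intro integral_completion) simp
    also have "\<dots> = 0"
      unfolding q_def using tr int by simp
    finally show ?thesis .
  qed
  have lim: "AE x in lebesgue. (\<lambda>k. q k x) \<longlonglongrightarrow> \<psi>' x"
    using diff
  proof eventually_elim
    case (elim x)
    then have l: "((\<lambda>t. (\<psi> (x + t *\<^sub>R i) - \<psi> x) / t) \<longlongrightarrow> \<psi>' x) (at 0)"
      by (simp add: has_field_derivative_iff)
    have "filterlim (\<lambda>k. inverse (real (Suc k))) (at 0) sequentially"
      by (intro filterlim_atI LIMSEQ_inverse_real_of_nat) auto
    from filterlim_compose[OF l this] show ?case
      by (simp add: q_def divide_inverse)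
  qed
  have wint: "integrable lebesgue w"
    unfolding w_def using lmeasurable_cball[of "0::'a" "R + 1"]
    by (intro integrable_mult_right integrable_real_indicator) (auto simp: fmeasurable_def)
  have bd: "AE x in lebesgue. norm (q k x) \<le> w x" for k
  proof (intro AE_I2)
    fix x
    let ?t = "inverse (real (Suc k))"
    have t: "0 < ?t" by simp
    have t1: "?t \<le> 1" by (rule inverse_le_1_iff[THEN iffD2]) simp
    show "norm (q k x) \<le> w x"
    proof (cases "norm x \<le> R + 1")
      case True
      have "\<bar>q k x\<bar> = \<bar>\<psi> (x + ?t *\<^sub>R i) - \<psi> x\<bar> * real (Suc k)"
        by (simp add: q_def abs_mult)
      also have "\<dots> \<le> (L * \<bar>?t\<bar>) * real (Suc k)"
        using t t1 by (intro mult_right_mono lip) simp_all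
      also have "\<dots> = L" using t by (simp add: mult.assoc del: of_nat_Suc)
      finally show ?thesis using True by (simp add: w_def)
    next
      case False
      have "norm x - norm (?t *\<^sub>R i) \<le> norm (x + ?t *\<^sub>R i)"
        using norm_triangle_ineq4[of "x + ?t *\<^sub>R i" "?t *\<^sub>R i"] by simp
      moreover have "norm (?t *\<^sub>R i) \<le> 1"
        unfolding norm_scaleR using t t1 i by (intro mult_le_one) simp_all
      ultimately have "norm (x + ?t *\<^sub>R i) > R" "norm x > R" using False by linarith+
      then have "\<psi> (x + ?t *\<^sub>R i) = 0" "\<psi> x = 0" by (blast intro: supp)+
      then show ?thesis by (simp add: q_def w_def False)
    qed
  qed
  have qm: "q k \<in> borel_measurable lebesgue" for k
    using qb[of k] by (intro measurable_completion) simp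
  show "integrable lebesgue \<psi>'"
    by (rule integrable_dominated_convergence[OF meas qm wint lim bd])
  have "(\<lambda>k. integral\<^sup>L lebesgue (q k)) \<longlonglongrightarrow> integral\<^sup>L lebesgue \<psi>'"
    by (rule integral_dominated_convergence[OF meas qm wint lim bd])
  then show "integral\<^sup>L lebesgue \<psi>' = 0"
    using q0 by (simp add: LIMSEQ_const_iff)
qed

lemma lipschitz_on_mult_bounded:
  fixes f g :: "'a::metric_space \<Rightarrow> real"
  assumes "L-lipschitz_on S f" "M-lipschitz_on S g"
    and "\<And>x. x \<in> S \<Longrightarrow> \<bar>f x\<bar> \<le> A" "\<And>x. x \<in> S \<Longrightarrow> \<bar>g x\<bar> \<le> B" "0 \<le> A" "0 \<le> B"
  shows "(A * M + B * L)-lipschitz_on S (\<lambda>x. f x * g x)"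
proof (rule lipschitz_onI)
  fix x y assume xy: "x \<in> S" "y \<in> S"
  have "\<bar>f x * g x - f y * g y\<bar> = \<bar>f x * (g x - g y) + (f x - f y) * g y\<bar>"
    by (simp add: algebra_simps)
  also have "\<dots> \<le> \<bar>f x\<bar> * \<bar>g x - g y\<bar> + \<bar>f x - f y\<bar> * \<bar>g y\<bar>"
    by (metis abs_mult abs_triangle_ineq)
  also have "\<dots> \<le> A * (M * dist x y) + (L * dist x y) * B"
    using xy assms(3-6) lipschitz_onD[OF assms(1), of x y] lipschitz_onD[OF assms(2), of x y]
      lipschitz_on_nonneg[OF assms(1)]
    by (intro add_mono mult_mono) (auto simp: dist_real_def)
  finally show "dist (f x * g x) (f y * g y) \<le> (A * M + B * L) * dist x y"
    by (simp add: dist_real_def algebra_simps)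
next
  show "0 \<le> A * M + B * L"
    by (intro add_nonneg_nonneg mult_nonneg_nonneg assms(5,6) lipschitz_on_nonneg[OF assms(1)]
        lipschitz_on_nonneg[OF assms(2)])
qed

lemma lipschitz_on_imp_bounded_cball:
  fixes f :: "'a::euclidean_space \<Rightarrow> real"
  assumes "L-lipschitz_on (cball 0 2) f"
  obtains A where "0 \<le> A" "\<And>x. x \<in> cball 0 2 \<Longrightarrow> \<bar>f x\<bar> \<le> A"
proof
  have L: "0 \<le> L" using assms by (rule lipschitz_on_nonneg)
  then show "0 \<le> \<bar>f 0\<bar> + L * 2" by simp
  fix x :: 'a assume x: "x \<in> cball 0 2"
  have "\<bar>f x - f 0\<bar> \<le> L * dist x 0"
    using lipschitz_onD[OF assms x, of 0] by (simp add: dist_real_def)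
  also have "\<dots> \<le> L * 2" using x L by (intro mult_left_mono) auto
  finally show "\<bar>f x\<bar> \<le> \<bar>f 0\<bar> + L * 2" by linarith
qed

text \<open>
  The closed ball of radius \<open>2\<close> is used throughout because test functions live in the unit ball and
  difference quotients with steps of length at most \<open>1\<close> do not leave it.
\<close>

lemma C1_imp_lipschitz_on_cball:
  fixes f :: "'a::euclidean_space \<Rightarrow> real"
  assumes "\<And>x. (f has_derivative (\<lambda>h. G x \<bullet> h)) (at x)" "continuous_on UNIV G"
  obtains L where "L-lipschitz_on (cball 0 2) f"
proof -
  have "compact (G ` cball 0 2)"
    using assms(2) by (intro compact_continuous_image) (auto intro: continuous_on_subset)
  then obtain L where L: "\<And>x. x \<in> cball 0 2 \<Longrightarrow> norm (G x) \<le> L"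
    using compact_imp_bounded bounded_iff by (metis imageI)
  have "L-lipschitz_on (cball 0 2) f"
  proof (rule bounded_derivative_imp_lipschitz)
    show "(f has_derivative (\<lambda>h. G x \<bullet> h)) (at x within cball 0 2)" for x
      using assms(1) by (rule has_derivative_at_withinI)
    show "onorm (\<lambda>h. G x \<bullet> h) \<le> L" if "x \<in> cball 0 2" for x
      using Cauchy_Schwarz_ineq2[of "G x"] L[OF that]
      by (intro onorm_le) (metis mult_right_mono norm_ge_zero order_trans real_norm_def)
    show "0 \<le> L" using order_trans[OF norm_ge_zero L[of 0]] by simp
  qed auto
  then show ?thesis by (rule that)
qed

lemma integral_lebesgue_on_eq:
  fixes f :: "'a::euclidean_space \<Rightarrow> real"
  assumes "S \<in> sets lebesgue" "\<And>x. x \<notin> S \<Longrightarrow> f x = 0"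
  shows "integral\<^sup>L (lebesgue_on S) f = integral\<^sup>L lebesgue f"
    "integrable (lebesgue_on S) f \<longleftrightarrow> integrable lebesgue f"
proof -
  have "(\<lambda>x. indicator S x *\<^sub>R f x) = f" using assms(2) by (force simp: indicator_def)
  then show "integral\<^sup>L (lebesgue_on S) f = integral\<^sup>L lebesgue f"
    "integrable (lebesgue_on S) f \<longleftrightarrow> integrable lebesgue f"
    using assms(1) by (simp_all add: integral_restrict_space integrable_restrict_space)
qed

lemma integrable_ball_bounded:
  fixes f :: "'a::euclidean_space \<Rightarrow> 'b::euclidean_space"
  assumes "f \<in> borel_measurable (lebesgue_on (ball a r))" "\<And>x. x \<in> ball a r \<Longrightarrow> norm (f x) \<le> B"
  shows "integrable (lebesgue_on (ball a r)) f"
proof -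
  interpret finite_measure "lebesgue_on (ball a r)"
    by (rule finite_measure_lebesgue_on) simp
  show ?thesis
    by (rule integrable_const_bound[of _ B]) (use assms in auto)
qed

text \<open>
  The product \<open>a * \<phi>\<close> extends by zero to a Lipschitz function with bounded support, so the integral of
  its derivative in the direction \<open>i\<close> vanishes.
\<close>

lemma integration_by_parts:
  fixes a :: "'a::euclidean_space \<Rightarrow> real"
  assumes \<phi>: "test_function (ball 0 1) \<phi>" and i: "i \<in> Basis"
    and cont: "continuous_on UNIV a" and lip: "L-lipschitz_on (cball 0 2) a"
    and diff: "AE x in lebesgue. ((\<lambda>t. a (x + t *\<^sub>R i)) has_real_derivative a' x) (at 0)"
    and meas: "a' \<in> borel_measurable lebesgue"
  shows "integrable (lebesgue_on (ball 0 1)) (\<lambda>x. a' x * \<phi> x)" (is ?th1)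
    "integrable (lebesgue_on (ball 0 1)) (\<lambda>x. a x * (gradient \<phi> x \<bullet> i))" (is ?th2)
    "(LINT x|lebesgue_on (ball 0 1). a x * (gradient \<phi> x \<bullet> i)) =
       - (LINT x|lebesgue_on (ball 0 1). a' x * \<phi> x)" (is ?th3)
proof -
  note T = test_functionD[OF \<phi>]
  let ?\<psi> = "\<lambda>x. a x * \<phi> x"
  let ?\<psi>' = "\<lambda>x. a' x * \<phi> x + a x * (gradient \<phi> x \<bullet> i)"
  obtain M where M: "M-lipschitz_on (cball 0 2) \<phi>"
    using C1_imp_lipschitz_on_cball[OF T(3,2)] by blast
  obtain A B where AB: "0 \<le> A" "0 \<le> B" "\<And>x. x \<in> cball 0 2 \<Longrightarrow> \<bar>a x\<bar> \<le> A" "\<And>x. x \<in> cball 0 2 \<Longrightarrow> \<bar>\<phi> x\<bar> \<le> B"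
    using lipschitz_on_imp_bounded_cball[OF lip] lipschitz_on_imp_bounded_cball[OF M] by metis
  define K where "K = A * M + B * L"
  have K: "K-lipschitz_on (cball 0 2) ?\<psi>"
    unfolding K_def by (rule lipschitz_on_mult_bounded[OF lip M]) (use AB in auto)
  then have K0: "0 \<le> K" by (rule lipschitz_on_nonneg)
  have z: "?\<psi> x = 0" if "norm x \<ge> 1" for x using T(4)[of x] that by auto
  have int2: "integrable lebesgue (\<lambda>x. a x * (gradient \<phi> x \<bullet> i))"
  proof -
    have "integrable lborel (\<lambda>x. indicator (cball 0 1) x *\<^sub>R (a x * (gradient \<phi> x \<bullet> i)))"
      by (rule borel_integrable_compact)
        (auto intro!: continuous_intros continuous_on_subset[OF cont] continuous_on_subset[OF T(2)])
    also have "(\<lambda>x. indicator (cball 0 1) x *\<^sub>R (a x * (gradient \<phi> x \<bullet> i))) =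
         (\<lambda>x. a x * (gradient \<phi> x \<bullet> i))"
      using T(5) by (force simp: indicator_def)
    finally show ?thesis
      by (subst integrable_completion)
        (auto intro!: borel_measurable_continuous_onI continuous_intros cont T(2))
  qed
  have i1: "norm i = 1" using i by simp
  have meas\<phi>: "\<phi> \<in> borel_measurable lebesgue" 
    using borel_measurable_continuous_onI[OF T(1)] by (intro measurable_completion) simp
  have p1: "continuous_on UNIV ?\<psi>" by (intro continuous_intros cont T(1))
  have p2: "?\<psi> x = 0" if "norm x > 1" for x using z[of x] that by simp
  have p3: "norm i \<le> 1" using i1 by simp
  have p4: "\<bar>?\<psi> (x + t *\<^sub>R i) - ?\<psi> x\<bar> \<le> K * \<bar>t\<bar>" if t: "\<bar>t\<bar> \<le> 1" for x t
  proof -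
    have n: "norm (t *\<^sub>R i) \<le> 1" using i1 t by simp
    \<comment> \<open>If one end of the step lies in the unit ball, then both lie in the ball of radius \<open>2\<close>,
      where the Lipschitz bounds hold; otherwise the product vanishes at both ends.\<close>
    consider "norm x \<ge> 1 \<and> norm (x + t *\<^sub>R i) \<ge> 1" | "x \<in> cball 0 2 \<and> x + t *\<^sub>R i \<in> cball 0 2"
      using n norm_triangle_ineq[of x "t *\<^sub>R i"] norm_triangle_ineq4[of "x + t *\<^sub>R i" "t *\<^sub>R i"]
      by fastforce
    then show ?thesis
    proof cases
      case 1
      then have z1: "?\<psi> x = 0" and z2: "?\<psi> (x + t *\<^sub>R i) = 0" using z by blast+
      show ?thesis unfolding z1 z2 using K0 by simp
    next
      case 2
      then have "dist (?\<psi> (x + t *\<^sub>R i)) (?\<psi> x) \<le> K * dist (x + t *\<^sub>R i) x"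
        by (intro lipschitz_onD[OF K]) auto
      then show ?thesis by (simp add: dist_real_def dist_norm i1)
    qed
  qed
  have p5: "AE x in lebesgue. ((\<lambda>t. ?\<psi> (x + t *\<^sub>R i)) has_real_derivative ?\<psi>' x) (at 0)"
    using diff
  proof eventually_elim
    case (elim x)
    note directional_derivative[OF T(3)[of x], of i]
    from DERIV_mult[OF elim this] show ?case by (simp add: mult.commute)
  qed
  have p6: "?\<psi>' \<in> borel_measurable lebesgue"
    using meas meas\<phi> int2 by measurable
  have d: "integrable lebesgue ?\<psi>'" "integral\<^sup>L lebesgue ?\<psi>' = 0"
    by (rule integral_directional_derivative_eq_0[where R = 1, OF p1 p2 p3 p4 p5 p6]; assumption)+
  have int1: "integrable lebesgue (\<lambda>x. a' x * \<phi> x)"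
    using Bochner_Integration.integrable_diff[OF d(1) int2] by simp
  have e: "integrable (lebesgue_on (ball 0 1)) (\<lambda>x. a' x * \<phi> x) = integrable lebesgue (\<lambda>x. a' x * \<phi> x)"
     "integral\<^sup>L (lebesgue_on (ball 0 1)) (\<lambda>x. a' x * \<phi> x) = integral\<^sup>L lebesgue (\<lambda>x. a' x * \<phi> x)"
     "integrable (lebesgue_on (ball 0 1)) (\<lambda>x. a x * (gradient \<phi> x \<bullet> i)) = integrable lebesgue (\<lambda>x. a x * (gradient \<phi> x \<bullet> i))"
     "integral\<^sup>L (lebesgue_on (ball 0 1)) (\<lambda>x. a x * (gradient \<phi> x \<bullet> i)) = integral\<^sup>L lebesgue (\<lambda>x. a x * (gradient \<phi> x \<bullet> i))"
    using T(4,5) by (auto intro!: integral_lebesgue_on_eq)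
  show ?th1 ?th2 using int1 int2 e by auto
  have "integral\<^sup>L lebesgue ?\<psi>' = integral\<^sup>L lebesgue (\<lambda>x. a' x * \<phi> x) +
      integral\<^sup>L lebesgue (\<lambda>x. a x * (gradient \<phi> x \<bullet> i))"
    by (rule Bochner_Integration.integral_add[OF int1 int2])
  with d(2) show ?th3 unfolding e by linarith
qed

section \<open>The weak formulation\<close>

lemma norm_diff_sq_le:
  fixes a b :: "'b::real_inner"
  shows "(norm (a - b))\<^sup>2 \<le> 2 * (norm a)\<^sup>2 + 2 * (norm b)\<^sup>2"
proof -
  have "(norm (a - b))\<^sup>2 + (norm (a + b))\<^sup>2 = 2 * (norm a)\<^sup>2 + 2 * (norm b)\<^sup>2"
    unfolding power2_norm_eq_inner
    by (simp add: inner_diff_left inner_diff_right inner_add_left inner_add_right inner_commute[of b a])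
  then show ?thesis using zero_le_power2[of "norm (a + b)"] by linarith
qed

lemma abs_inner_le_sq_sum:
  fixes a b :: "'b::real_inner"
  shows "\<bar>a \<bullet> b\<bar> \<le> (norm a)\<^sup>2 + (norm b)\<^sup>2"
proof -
  have "2 * (norm a * norm b) \<le> (norm a)\<^sup>2 + (norm b)\<^sup>2"
    using zero_le_power2[of "norm a - norm b"] by (simp add: power2_diff)
  moreover have "0 \<le> norm a * norm b" by simp
  ultimately show ?thesis using Cauchy_Schwarz_ineq2[of a b] by linarith
qed

lemma square_integrable_diff:
  fixes f g :: "'a::euclidean_space \<Rightarrow> 'b::euclidean_space"
  assumes "square_integrable \<Omega> f" "square_integrable \<Omega> g"
  shows "square_integrable \<Omega> (\<lambda>x. f x - g x)"
  unfolding square_integrable_def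
proof
  show m: "(\<lambda>x. f x - g x) \<in> borel_measurable (lebesgue_on \<Omega>)"
    using assms unfolding square_integrable_def by (intro borel_measurable_diff) auto
  show "integrable (lebesgue_on \<Omega>) (\<lambda>x. (norm (f x - g x))\<^sup>2)"
  proof (rule Bochner_Integration.integrable_bound)
    show "integrable (lebesgue_on \<Omega>) (\<lambda>x. 2 * (norm (f x))\<^sup>2 + 2 * (norm (g x))\<^sup>2)"
      using assms by (auto simp: square_integrable_def)
    show "(\<lambda>x. (norm (f x - g x))\<^sup>2) \<in> borel_measurable (lebesgue_on \<Omega>)"
      using m by measurable
    show "AE x in lebesgue_on \<Omega>. norm ((norm (f x - g x))\<^sup>2) \<le> norm (2 * (norm (f x))\<^sup>2 + 2 * (norm (g x))\<^sup>2)"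
      using norm_diff_sq_le by auto
  qed
qed

lemma square_integrable_inner:
  fixes f g :: "'a::euclidean_space \<Rightarrow> 'b::euclidean_space"
  assumes "square_integrable \<Omega> f" "square_integrable \<Omega> g"
  shows "integrable (lebesgue_on \<Omega>) (\<lambda>x. f x \<bullet> g x)"
proof (rule Bochner_Integration.integrable_bound)
  show "integrable (lebesgue_on \<Omega>) (\<lambda>x. (norm (f x))\<^sup>2 + (norm (g x))\<^sup>2)"
    using assms by (auto simp: square_integrable_def)
  show "(\<lambda>x. f x \<bullet> g x) \<in> borel_measurable (lebesgue_on \<Omega>)"
    using assms unfolding square_integrable_def by (intro borel_measurable_inner) auto
  show "AE x in lebesgue_on \<Omega>. norm (f x \<bullet> g x) \<le> norm ((norm (f x))\<^sup>2 + (norm (g x))\<^sup>2)"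
    using abs_inner_le_sq_sum by auto
qed

lemma integrable_continuous_cball:
  fixes f :: "'a::euclidean_space \<Rightarrow> 'b::euclidean_space"
  assumes f: "continuous_on (cball a r) f"
  shows "integrable (lebesgue_on (ball a r)) f"
proof -
  have "compact (f ` cball a r)" using f by (rule compact_continuous_image) simp
  then obtain B where B: "\<And>x. x \<in> cball a r \<Longrightarrow> norm (f x) \<le> B"
    using compact_imp_bounded bounded_iff by (metis imageI)
  have "continuous_on (ball a r) f" using f by (rule continuous_on_subset) auto
  then have "f \<in> borel_measurable (lebesgue_on (ball a r))"
    by (rule continuous_imp_measurable_on_sets_lebesgue) simp
  then show ?thesis by (rule integrable_ball_bounded[where B = B]) (use B in auto)
qed

lemma integrable_ball_continuous:
  fixes f :: "'a::euclidean_space \<Rightarrow> 'b::euclidean_space"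
  assumes "continuous_on UNIV f"
  shows "integrable (lebesgue_on (ball a r)) f"
  by (rule integrable_continuous_cball[OF continuous_on_subset[OF assms subset_UNIV]])

lemma square_integrable_continuous:
  fixes f :: "'a::euclidean_space \<Rightarrow> 'b::euclidean_space"
  assumes "continuous_on UNIV f"
  shows "square_integrable (ball a r) f"
  unfolding square_integrable_def using assms
  by (auto intro!: integrable_ball_continuous continuous_intros
      borel_measurable_integrable[OF integrable_ball_continuous])

text \<open>
  Integrating by parts against \<open>(x \<bullet> i) * \<phi> x\<close> gives \<open>\<integral>\<phi>\<^sup>2 = - 2 * \<integral>(x \<bullet> i) * \<phi> * \<partial>\<^sub>i\<phi>\<close>. As
  \<open>\<bar>x \<bullet> i\<bar> \<le> 1\<close>, half of the left-hand side absorbs the factor \<open>\<phi>\<close> on the right.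
\<close>

lemma poincare_inequality:
  fixes \<phi> :: "'a::euclidean_space \<Rightarrow> real"
  assumes \<phi>: "test_function (ball 0 1) \<phi>"
  shows "(LINT x|lebesgue_on (ball 0 1). (\<phi> x)\<^sup>2) \<le> 4 * (LINT x|lebesgue_on (ball 0 1). (norm (gradient \<phi> x))\<^sup>2)"
proof -
  note T = test_functionD[OF \<phi>]
  let ?M = "lebesgue_on (ball (0::'a) 1)"
  obtain i :: 'a where i: "i \<in> Basis" using nonempty_Basis by blast
  let ?a = "\<lambda>x. (x \<bullet> i) * \<phi> x" and ?D = "\<lambda>x. gradient \<phi> x \<bullet> i"
  let ?a' = "\<lambda>x. \<phi> x + (x \<bullet> i) * ?D x"
  have der: "(?a has_derivative (\<lambda>h. ((x \<bullet> i) *\<^sub>R gradient \<phi> x + \<phi> x *\<^sub>R i) \<bullet> h)) (at x)" for x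
    using T(3)[of x]
    by (auto intro!: derivative_eq_intros simp: inner_add_left inner_commute[of i] algebra_simps)
  have ca: "continuous_on UNIV ?a" by (intro continuous_intros T(1))
  have ca': "continuous_on UNIV ?a'" by (intro continuous_intros T(1,2))
  obtain L where L: "L-lipschitz_on (cball 0 2) ?a"
    by (rule C1_imp_lipschitz_on_cball[OF der]) (intro continuous_intros T(1,2))
  have dir: "((\<lambda>t. ?a (x + t *\<^sub>R i)) has_real_derivative ?a' x) (at 0)" for x
    using directional_derivative[OF der[of x], of i] i by (simp add: inner_add_left add.commute)
  have ma': "?a' \<in> borel_measurable lebesgue"
    using borel_measurable_continuous_onI[OF ca'] by (intro measurable_completion) simp
  have "(LINT x|?M. ?a x * ?D x) = - (LINT x|?M. ?a' x * \<phi> x)"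
    by (rule integration_by_parts(3)[OF \<phi> i ca L _ ma']) (use dir in auto)
  moreover have I: "integrable ?M (\<lambda>x. ?a x * ?D x)" "integrable ?M (\<lambda>x. (\<phi> x)\<^sup>2)"
    "integrable ?M (\<lambda>x. (norm (gradient \<phi> x))\<^sup>2)"
    by (intro integrable_ball_continuous continuous_intros T(1,2))+
  moreover have "(LINT x|?M. ?a' x * \<phi> x) = (LINT x|?M. (\<phi> x)\<^sup>2 + ?a x * ?D x)"
    by (intro Bochner_Integration.integral_cong) (auto simp: algebra_simps power2_eq_square)
  ultimately have eq: "(LINT x|?M. (\<phi> x)\<^sup>2) = (LINT x|?M. (-2) * (?a x * ?D x))"
    by simp
  also have "\<dots> \<le> (LINT x|?M. (\<phi> x)\<^sup>2 / 2 + 2 * (norm (gradient \<phi> x))\<^sup>2)"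
  proof (rule integral_mono)
    fix x :: 'a assume "x \<in> space ?M"
    then have "norm x \<le> 1" by simp
    then have x1: "\<bar>x \<bullet> i\<bar> \<le> 1" using Basis_le_norm[OF i, of x] by linarith
    have D: "\<bar>?D x\<bar> \<le> norm (gradient \<phi> x)" using Basis_le_norm[OF i] .
    have "(-2) * (?a x * ?D x) \<le> 2 * \<bar>\<phi> x\<bar> * (\<bar>x \<bullet> i\<bar> * \<bar>?D x\<bar>)"
    proof -
      have "2 * \<bar>\<phi> x\<bar> * (\<bar>x \<bullet> i\<bar> * \<bar>?D x\<bar>) = 2 * \<bar>?a x * ?D x\<bar>"
        by (simp add: abs_mult)
      then show ?thesis using abs_ge_minus_self[of "?a x * ?D x"] by linarith
    qed
    also have "\<dots> \<le> 2 * \<bar>\<phi> x\<bar> * (1 * norm (gradient \<phi> x))"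
      using x1 D by (intro mult_left_mono mult_mono) auto
    also have "\<dots> \<le> (\<phi> x)\<^sup>2 / 2 + 2 * (norm (gradient \<phi> x))\<^sup>2"
      using zero_le_power2[of "\<bar>\<phi> x\<bar> - 2 * norm (gradient \<phi> x)"]
      by (simp add: power2_diff power_mult_distrib)
    finally show "(-2) * (?a x * ?D x) \<le> (\<phi> x)\<^sup>2 / 2 + 2 * (norm (gradient \<phi> x))\<^sup>2" .
  qed (use I in auto)
  finally show ?thesis using I by simp
qed

lemma test_function_diff:
  assumes "test_function \<Omega> \<phi>" "test_function \<Omega> \<psi>"
  shows "test_function \<Omega> (\<lambda>x. \<phi> x - \<psi> x)"
    and "gradient (\<lambda>x. \<phi> x - \<psi> x) x = gradient \<phi> x - gradient \<psi> x"
proof -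
  let ?A = "closure {x. \<phi> x \<noteq> 0}" and ?B = "closure {x. \<psi> x \<noteq> 0}"
    and ?C = "closure {x. \<phi> x - \<psi> x \<noteq> 0}"
  have AB: "\<And>k. Ck k \<phi>" "compact ?A" "?A \<subseteq> \<Omega>" "\<And>k. Ck k \<psi>" "compact ?B" "?B \<subseteq> \<Omega>"
    using assms unfolding test_function_def by blast+
  have sub: "?C \<subseteq> ?A \<union> ?B"
    unfolding closure_Un[symmetric] by (rule closure_mono) auto
  have "compact ((?A \<union> ?B) \<inter> ?C)"
    by (intro compact_Int_closed compact_Un AB closed_closure)
  then have "compact ?C"
    unfolding Int_absorb1[OF sub] .
  moreover have "?C \<subseteq> \<Omega>" using sub AB(3,6) by blast
  ultimately show "test_function \<Omega> (\<lambda>x. \<phi> x - \<psi> x)"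
    unfolding test_function_def using Ck_diff[OF AB(1,4)] by blast
  have "((\<lambda>x. \<phi> x - \<psi> x) has_derivative (\<lambda>h. (gradient \<phi> x - gradient \<psi> x) \<bullet> h)) (at x)"
    unfolding inner_diff_left
    by (intro has_derivative_diff test_functionD(3)[OF assms(1)] test_functionD(3)[OF assms(2)])
  then show "gradient (\<lambda>x. \<phi> x - \<psi> x) x = gradient \<phi> x - gradient \<psi> x"
    by (rule gradientI)
qed

lemma square_integrable_test_function:
  assumes "test_function \<Omega> \<phi>"
  shows "square_integrable (ball a r) \<phi>" "square_integrable (ball a r) (gradient \<phi>)"
  using test_functionD[OF assms] by (auto intro: square_integrable_continuous)

text \<open>
  The difference of the approximating test functions has gradient close to \<open>0\<close>, hence is itself close
  to \<open>0\<close> by the Poincare inequality. The statement cannot be read off from the weak gradient alone: the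
  zero boundary values enter through the approximation.
\<close>

lemma H10_gradient_injective:
  fixes u v :: "'a::euclidean_space \<Rightarrow> real"
  assumes u: "H10 (ball 0 1) u g" and v: "H10 (ball 0 1) v h"
    and eq: "AE x in lebesgue_on (ball 0 1). g x = h x"
  shows "AE x in lebesgue_on (ball 0 1). u x = v x"
proof -
  let ?M = "lebesgue_on (ball (0::'a) 1)"
  define e where "e u g \<phi> = (\<lambda>x::'a. (u x - \<phi> x)\<^sup>2 + (norm (g x - gradient \<phi> x))\<^sup>2)"
    for u \<phi> :: "'a \<Rightarrow> real" and g
  obtain \<phi> where \<phi>: "\<And>k. test_function (ball 0 1) (\<phi> k)" "(\<lambda>k. integral\<^sup>L ?M (e u g (\<phi> k))) \<longlonglongrightarrow> 0"
    using u unfolding H10_def e_def by blast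
  obtain \<psi> where \<psi>: "\<And>k. test_function (ball 0 1) (\<psi> k)" "(\<lambda>k. integral\<^sup>L ?M (e v h (\<psi> k))) \<longlonglongrightarrow> 0"
    using v unfolding H10_def e_def by blast
  have sq: "square_integrable (ball 0 1) u" "square_integrable (ball 0 1) g"
    "square_integrable (ball 0 1) v" "square_integrable (ball 0 1) h"
    using u v by (auto simp: H10_def H1_def)
  note sq\<phi> = square_integrable_test_function[OF \<phi>(1)] 
  note sq\<psi> = square_integrable_test_function[OF \<psi>(1)]
  have int: "integrable ?M (e u g (\<phi> k))" "integrable ?M (e v h (\<psi> k))" for k
    using square_integrable_diff[OF sq(1) sq\<phi>(1)] square_integrable_diff[OF sq(2) sq\<phi>(2)]
      square_integrable_diff[OF sq(3) sq\<psi>(1)] square_integrable_diff[OF sq(4) sq\<psi>(2)]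
    by (auto simp: e_def square_integrable_def)
  have intw: "integrable ?M (\<lambda>x. (u x - v x)\<^sup>2)"
    using square_integrable_diff[OF sq(1,3)] by (simp add: square_integrable_def)
  have bound: "(LINT x|?M. (u x - v x)\<^sup>2) \<le> 20 * integral\<^sup>L ?M (e u g (\<phi> k)) + 20 * integral\<^sup>L ?M (e v h (\<psi> k))" for k
  proof -
    define \<eta> where "\<eta> x = \<phi> k x - \<psi> k x" for x
    have \<eta>: "test_function (ball 0 1) \<eta>" "gradient \<eta> x = gradient (\<phi> k) x - gradient (\<psi> k) x" for x
      unfolding \<eta>_def by (rule test_function_diff[OF \<phi>(1) \<psi>(1)])+
    have I: "integrable ?M (\<lambda>x. (\<eta> x)\<^sup>2)" "integrable ?M (\<lambda>x. (norm (gradient \<eta> x))\<^sup>2)"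
      using square_integrable_test_function[OF \<eta>(1)] by (auto simp: square_integrable_def)
    have "(LINT x|?M. (u x - v x)\<^sup>2) \<le>
        (LINT x|?M. 2 * (\<eta> x)\<^sup>2 + 4 * e u g (\<phi> k) x + 4 * e v h (\<psi> k) x)"
    proof (rule integral_mono)
      fix x
      have "(p + q + r)\<^sup>2 \<le> 2 * p\<^sup>2 + 4 * q\<^sup>2 + 4 * r\<^sup>2" for p q r :: real
        using zero_le_power2[of "p - (q + r)"] zero_le_power2[of "q - r"]
        by (simp add: power2_eq_square algebra_simps)
      from this[of "\<eta> x" "u x - \<phi> k x" "\<psi> k x - v x"]
      have "(u x - v x)\<^sup>2 \<le> 2 * (\<eta> x)\<^sup>2 + 4 * (u x - \<phi> k x)\<^sup>2 + 4 * (v x - \<psi> k x)\<^sup>2"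
        by (simp add: \<eta>_def power2_commute)
      then show "(u x - v x)\<^sup>2 \<le> 2 * (\<eta> x)\<^sup>2 + 4 * e u g (\<phi> k) x + 4 * e v h (\<psi> k) x"
        using zero_le_power2[of "norm (g x - gradient (\<phi> k) x)"]
          zero_le_power2[of "norm (h x - gradient (\<psi> k) x)"]
        unfolding e_def distrib_left by linarith
    qed (use int I intw in auto)
    also have "\<dots> = 2 * (LINT x|?M. (\<eta> x)\<^sup>2) + 4 * integral\<^sup>L ?M (e u g (\<phi> k)) + 4 * integral\<^sup>L ?M (e v h (\<psi> k))"
      using int[of k] I by simp
    also have "(LINT x|?M. (\<eta> x)\<^sup>2) \<le> 4 * (LINT x|?M. (norm (gradient \<eta> x))\<^sup>2)"
      by (rule poincare_inequality[OF \<eta>(1)])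
    also have "(LINT x|?M. (norm (gradient \<eta> x))\<^sup>2) \<le> (LINT x|?M. 2 * e u g (\<phi> k) x + 2 * e v h (\<psi> k) x)"
    proof (rule integral_mono_AE)
      show "AE x in ?M. (norm (gradient \<eta> x))\<^sup>2 \<le> 2 * e u g (\<phi> k) x + 2 * e v h (\<psi> k) x"
        using eq
      proof eventually_elim
        case (elim x)
        have "gradient \<eta> x = (h x - gradient (\<psi> k) x) - (g x - gradient (\<phi> k) x)"
          by (simp add: \<eta> elim)
        then have "(norm (gradient \<eta> x))\<^sup>2 \<le>
            2 * (norm (h x - gradient (\<psi> k) x))\<^sup>2 + 2 * (norm (g x - gradient (\<phi> k) x))\<^sup>2"
          using norm_diff_sq_le by metis
        then show ?case
          using zero_le_power2[of "u x - \<phi> k x"] zero_le_power2[of "v x - \<psi> k x"]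
          unfolding e_def distrib_left by linarith
      qed
    qed (use int I in auto)
    finally show ?thesis using int[of k] by simp
  qed
  have "(\<lambda>k. 20 * integral\<^sup>L ?M (e u g (\<phi> k)) + 20 * integral\<^sup>L ?M (e v h (\<psi> k))) \<longlonglongrightarrow> 20 * 0 + 20 * 0"
    by (intro tendsto_intros \<phi>(2) \<psi>(2))
  from LIMSEQ_le_const[OF this, of "LINT x|?M. (u x - v x)\<^sup>2"] bound
  have "(LINT x|?M. (u x - v x)\<^sup>2) \<le> 0" by simp
  moreover have "(LINT x|?M. (u x - v x)\<^sup>2) \<ge> 0" by simp
  ultimately have "(LINT x|?M. (u x - v x)\<^sup>2) = 0" by linarith
  then have "AE x in ?M. (u x - v x)\<^sup>2 = 0"
    using integral_nonneg_eq_0_iff_AE[OF intw] by simp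
  then show ?thesis by eventually_elim simp
qed

text \<open>
  Testing both equations with both solutions gives four identities, whose alternating sum is
  \<open>\<integral>\<bar>g - h\<bar>\<^sup>2 = 0\<close>. Functions in \<open>H10\<close> with equal gradients then agree.
\<close>

proposition weak_solution_unique:
  fixes u v :: "'a::euclidean_space \<Rightarrow> real"
  assumes "weak_solution (ball 0 1) f u" "weak_solution (ball 0 1) f v"
  shows "AE x in lebesgue_on (ball 0 1). u x = v x"
proof -
  let ?M = "lebesgue_on (ball (0::'a) 1)"
  obtain g where g: "H10 (ball 0 1) u g"
    "\<And>w k. H10 (ball 0 1) w k \<Longrightarrow> (LINT x|?M. g x \<bullet> k x) = (LINT x|?M. f x * w x)"
    using assms(1) unfolding weak_solution_def by blast
  obtain h where h: "H10 (ball 0 1) v h"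
    "\<And>w k. H10 (ball 0 1) w k \<Longrightarrow> (LINT x|?M. h x \<bullet> k x) = (LINT x|?M. f x * w x)"
    using assms(2) unfolding weak_solution_def by blast
  have sq: "square_integrable (ball 0 1) g" "square_integrable (ball 0 1) h"
    using g(1) h(1) by (auto simp: H10_def H1_def)
  note I = square_integrable_inner[OF sq(1) sq(1)] square_integrable_inner[OF sq(1) sq(2)]
    square_integrable_inner[OF sq(2) sq(1)] square_integrable_inner[OF sq(2) sq(2)]
  have J: "integrable ?M (\<lambda>x. (norm (g x - h x))\<^sup>2)"
    using square_integrable_diff[OF sq] by (simp add: square_integrable_def)
  have "(LINT x|?M. (norm (g x - h x))\<^sup>2) =
      (LINT x|?M. g x \<bullet> g x - g x \<bullet> h x - (h x \<bullet> g x - h x \<bullet> h x))"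
    by (simp add: power2_norm_eq_inner inner_diff_left inner_diff_right algebra_simps)
  also have "\<dots> = 0"
    using I by (simp add: g(2)[OF g(1)] g(2)[OF h(1)] h(2)[OF g(1)] h(2)[OF h(1)])
  finally have "AE x in ?M. (norm (g x - h x))\<^sup>2 = 0"
    using integral_nonneg_eq_0_iff_AE[OF J] by simp
  then have "AE x in ?M. g x = h x" by eventually_elim simp
  then show ?thesis by (rule H10_gradient_injective[OF g(1) h(1)])
qed

text \<open>
  It is enough to test with smooth functions, both sides being continuous along the approximation of
  \<open>v\<close>. Instead of the Cauchy-Schwarz inequality the proof uses \<open>a * b \<le> l * a\<^sup>2 + b\<^sup>2 / l\<close>, first letting the
  approximation converge and then \<open>l\<close> tend to \<open>0\<close>.
\<close>

proposition weak_solutionI: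
  fixes u :: "'a::euclidean_space \<Rightarrow> real"
  assumes u: "H10 (ball 0 1) u g" and f: "square_integrable (ball 0 1) f"
    and test: "\<And>\<phi>. test_function (ball 0 1) \<phi> \<Longrightarrow>
      (LINT x|lebesgue_on (ball 0 1). g x \<bullet> gradient \<phi> x) = (LINT x|lebesgue_on (ball 0 1). f x * \<phi> x)"
  shows "weak_solution (ball 0 1) f u"
  unfolding weak_solution_def
proof (intro exI conjI allI impI)
  fix v :: "'a \<Rightarrow> real" and h assume v: "H10 (ball 0 1) v h"
  let ?M = "lebesgue_on (ball (0::'a) 1)"
  obtain \<phi> where \<phi>: "\<And>k. test_function (ball 0 1) (\<phi> k)"
    "(\<lambda>k. LINT x|?M. (v x - \<phi> k x)\<^sup>2 + (norm (h x - gradient (\<phi> k) x))\<^sup>2) \<longlonglongrightarrow> 0"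
    using v unfolding H10_def by blast
  define e where "e k = (LINT x|?M. (v x - \<phi> k x)\<^sup>2 + (norm (h x - gradient (\<phi> k) x))\<^sup>2)" for k
  have sq: "square_integrable (ball 0 1) g" "square_integrable (ball 0 1) v" "square_integrable (ball 0 1) h"
    using u v by (auto simp: H10_def H1_def)
  define X where "X = (LINT x|?M. g x \<bullet> h x) - (LINT x|?M. f x * v x)"
  define A where "A = (LINT x|?M. (norm (g x))\<^sup>2 + (f x)\<^sup>2)"
  have A: "0 \<le> A" unfolding A_def by simp
  have Xk: "\<bar>X\<bar> \<le> l * A + e k / l" if l: "0 < l" for l k
  proof -
    note sq\<phi> = square_integrable_test_function[OF \<phi>(1)]
    note d = square_integrable_diff[OF sq(2) sq\<phi>(1)] square_integrable_diff[OF sq(3) sq\<phi>(2)]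
    have I: "integrable ?M (\<lambda>x. g x \<bullet> h x)" "integrable ?M (\<lambda>x. f x * v x)"
      "integrable ?M (\<lambda>x. g x \<bullet> gradient (\<phi> k) x)" "integrable ?M (\<lambda>x. f x * \<phi> k x)"
      using square_integrable_inner[OF sq(1,3)] square_integrable_inner[OF f sq(2)]
        square_integrable_inner[OF sq(1) sq\<phi>(2)] square_integrable_inner[OF f sq\<phi>(1)] by simp_all
    have Q: "integrable ?M (\<lambda>x. (v x - \<phi> k x)\<^sup>2)" "integrable ?M (\<lambda>x. (norm (h x - gradient (\<phi> k) x))\<^sup>2)"
      "integrable ?M (\<lambda>x. (norm (g x))\<^sup>2)" "integrable ?M (\<lambda>x. (f x)\<^sup>2)"
      using d sq(1) f by (auto simp: square_integrable_def)
    have "X = (LINT x|?M. (g x \<bullet> h x - f x * v x) - (g x \<bullet> gradient (\<phi> k) x - f x * \<phi> k x))"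
      using I test[OF \<phi>(1), of k] by (simp add: X_def)
    also have "\<bar>\<dots>\<bar> \<le> (LINT x|?M. \<bar>(g x \<bullet> h x - f x * v x) - (g x \<bullet> gradient (\<phi> k) x - f x * \<phi> k x)\<bar>)"
      by (rule integral_abs_bound)
    also have "\<dots> \<le> (LINT x|?M. l * ((norm (g x))\<^sup>2 + (f x)\<^sup>2) +
        ((v x - \<phi> k x)\<^sup>2 + (norm (h x - gradient (\<phi> k) x))\<^sup>2) / l)"
    proof (rule integral_mono)
      fix x
      have young: "a * b \<le> l * a\<^sup>2 + b\<^sup>2 / l" if "0 \<le> a" "0 \<le> b" for a b :: real
      proof -
        have "0 \<le> (l * a - b)\<^sup>2 / l" using l by simp
        also have "\<dots> = l * a\<^sup>2 - 2 * (a * b) + b\<^sup>2 / l"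
          using l by (simp add: field_simps power2_eq_square)
        finally show ?thesis using mult_nonneg_nonneg[OF that] by linarith
      qed
      have "\<bar>(g x \<bullet> h x - f x * v x) - (g x \<bullet> gradient (\<phi> k) x - f x * \<phi> k x)\<bar> =
         \<bar>g x \<bullet> (h x - gradient (\<phi> k) x) - f x * (v x - \<phi> k x)\<bar>"
        by (simp add: inner_diff_right algebra_simps)
      also have "\<dots> \<le> norm (g x) * norm (h x - gradient (\<phi> k) x) + \<bar>f x\<bar> * \<bar>v x - \<phi> k x\<bar>"
        using Cauchy_Schwarz_ineq2[of "g x" "h x - gradient (\<phi> k) x"]
          abs_triangle_ineq4[of "g x \<bullet> (h x - gradient (\<phi> k) x)" "f x * (v x - \<phi> k x)"]
        by (simp add: abs_mult)
      also have "\<dots> \<le> (l * (norm (g x))\<^sup>2 + (norm (h x - gradient (\<phi> k) x))\<^sup>2 / l) + (l * \<bar>f x\<bar>\<^sup>2 + \<bar>v x - \<phi> k x\<bar>\<^sup>2 / l)"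
        by (intro add_mono young) auto
      finally show "\<bar>(g x \<bullet> h x - f x * v x) - (g x \<bullet> gradient (\<phi> k) x - f x * \<phi> k x)\<bar> \<le>
          l * ((norm (g x))\<^sup>2 + (f x)\<^sup>2) + ((v x - \<phi> k x)\<^sup>2 + (norm (h x - gradient (\<phi> k) x))\<^sup>2) / l"
        by (simp add: algebra_simps add_divide_distrib)
    qed (use I Q in \<open>auto intro!: integrable_abs\<close>)
    also have "\<dots> = l * A + e k / l"
      using Q by (simp add: A_def e_def)
    finally show ?thesis .
  qed
  have "\<bar>X\<bar> \<le> l * A" if l: "0 < l" for l
  proof -
    have "(\<lambda>k. l * A + e k / l) \<longlonglongrightarrow> l * A + 0 / l"
      using \<phi>(2) unfolding e_def by (intro tendsto_intros) (use l in auto)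
    then have "(\<lambda>k. l * A + e k / l) \<longlonglongrightarrow> l * A" by simp
    then show ?thesis by (rule LIMSEQ_le_const) (use Xk[OF l] in auto)
  qed
  then have small: "\<bar>X\<bar> \<le> l * A" if "0 < l" for l using that by blast
  have "X = 0"
  proof (rule ccontr)
    assume "X \<noteq> 0"
    then have pos: "0 < \<bar>X\<bar>" by simp
    have "\<bar>X\<bar> \<le> \<bar>X\<bar> / (2 * (A + 1)) * A"
      using pos A by (intro small) simp
    also have "\<dots> = \<bar>X\<bar> * (A / (2 * (A + 1)))" by simp
    also have "\<dots> \<le> \<bar>X\<bar> * (1 / 2)"
      using A by (intro mult_left_mono) (simp_all add: field_simps)
    finally show False using pos by simp
  qed
  then show "(LINT x|?M. g x \<bullet> h x) = (LINT x|?M. f x * v x)" by (simp add: X_def)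
qed (rule u)

section \<open>Radial functions with zero boundary values\<close>

lemma antiderivative_vanishing_at_1:
  fixes D :: "real \<Rightarrow> real"
  assumes "continuous_on UNIV D"
  obtains V where "V 1 = 0" "\<And>s. (V has_real_derivative D s) (at s)"
proof -
  have "\<exists>F. \<forall>x :: real. -\<infinity> < ereal x \<longrightarrow> ereal x < \<infinity> \<longrightarrow> (F has_vector_derivative D x) (at x)"
    by (rule einterval_antiderivative) (use assms in \<open>auto simp: continuous_on_eq_continuous_at\<close>)
  then obtain F where F: "\<And>x. (F has_real_derivative D x) (at x)"
    by (auto simp: has_real_derivative_iff_has_vector_derivative)
  show thesis
    by (rule that[of "\<lambda>s. F s - F 1"]) (auto intro!: derivative_eq_intros F)
qed

lemma vanishing_at_1_bound:
  fixes F :: "real \<Rightarrow> real"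
  assumes "F 1 = 0" "\<And>s. (F has_real_derivative F' s) (at s)"
    and "\<And>s. s \<in> {0..1} \<Longrightarrow> \<bar>F' s\<bar> \<le> B" and s: "s \<in> {0..1}"
  shows "\<bar>F s\<bar> \<le> B * (1 - s)"
proof -
  have "norm (F s - F 1) \<le> B * norm (s - 1)"
    by (rule field_differentiable_bound[of "{0..1}" F F'])
      (use assms in \<open>auto intro: has_field_derivative_at_within\<close>)
  moreover have "norm (s - 1) = 1 - s" using s by simp
  ultimately show ?thesis using assms(1) by simp
qed

text \<open>
  In the variable \<open>y = 1 / t\<close> the left-hand side is \<open>(y + y\<^sup>2) * exp (- y)\<close>. The factor \<open>t + 1\<close> is
  \<open>(k + 2) * (1 - s)\<close> when \<open>t\<close> is the argument of the cutoff below.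
\<close>

lemma flat_exp_derivative_bound:
  assumes "0 < t"
  shows "(t + 1) * ((inverse t)\<^sup>2 * flat_exp t) \<le> 2"
    and "(t + 1) * ((inverse t)\<^sup>2 * flat_exp t) \<le> inverse t + (inverse t)\<^sup>2"
proof -
  let ?y = "inverse t"
  have y: "0 < ?y" using assms by simp
  have eq: "(t + 1) * ((inverse t)\<^sup>2 * flat_exp t) = (?y + ?y\<^sup>2) * exp (- ?y)"
    using assms by (simp add: flat_exp_pos field_simps power2_eq_square)
  have "?y + ?y\<^sup>2 \<le> 2 * (1 + ?y + ?y\<^sup>2 / 2)" using y by simp
  also have "\<dots> \<le> 2 * exp ?y"
    using exp_lower_Taylor_quadratic[of ?y] y by simp
  finally have "(?y + ?y\<^sup>2) * exp (- ?y) \<le> 2 * exp ?y * exp (- ?y)"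
    by (intro mult_right_mono) auto
  also have "2 * exp ?y * exp (- ?y) = 2" by (simp add: exp_minus)
  finally show "(t + 1) * ((inverse t)\<^sup>2 * flat_exp t) \<le> 2"
    unfolding eq .
  have "(?y + ?y\<^sup>2) * exp (- ?y) \<le> (?y + ?y\<^sup>2) * 1"
    using y by (intro mult_left_mono) auto
  then show "(t + 1) * ((inverse t)\<^sup>2 * flat_exp t) \<le> ?y + ?y\<^sup>2"
    unfolding eq by simp
qed

lemma Ck_real_polynomial_function:
  fixes p :: "real \<Rightarrow> real"
  assumes "real_polynomial_function p"
  shows "Ck k p"
proof -
  obtain a n where "p = (\<lambda>x. \<Sum>i\<le>n. a i * x ^ i)"
    using real_polynomial_function_imp_sum[OF assms] by blast
  then show ?thesis
    by (simp only:) (intro Ck_sum Ck_mult Ck_const Ck_power Ck_linear[OF bounded_linear_ident] finite_atMost)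
qed

text \<open>
  One-dimensional core of the membership in \<open>H10\<close>. The derivative \<open>D\<close> is approximated by polynomials \<open>p\<close>
  on \<open>{0..1}\<close>, and \<open>\<Phi>\<close> is the antiderivative \<open>P\<close> of \<open>p\<close> vanishing at \<open>1\<close>, multiplied by a cutoff \<open>\<eta>\<close> at
  scale \<open>1 / (k + 2)\<close>. The dangerous term is \<open>\<eta>' * P\<close>. It stays bounded and tends to \<open>0\<close> because
  \<open>\<bar>P s\<bar> \<le> const * (1 - s)\<close> compensates the factor \<open>k + 2\<close> in \<open>\<eta>'\<close>.
\<close>

lemma smooth_approximation_vanishing_near_1:
  fixes D V :: "real \<Rightarrow> real"
  assumes D: "continuous_on UNIV D" and V: "V 1 = 0" "\<And>s. (V has_real_derivative D s) (at s)"
  obtains \<Phi> \<Phi>' :: "nat \<Rightarrow> real \<Rightarrow> real" and B where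
    "\<And>n k. Ck n (\<Phi> k)" "\<And>k s. (\<Phi> k has_real_derivative \<Phi>' k s) (at s)"
    "\<And>k s. s > 1 - 1 / (real k + 2) \<Longrightarrow> \<Phi> k s = 0"
    "\<And>s. s \<in> {0..<1} \<Longrightarrow> (\<lambda>k. \<Phi> k s) \<longlonglongrightarrow> V s"
    "\<And>s. s \<in> {0..<1} \<Longrightarrow> (\<lambda>k. \<Phi>' k s) \<longlonglongrightarrow> D s"
    "\<And>k s. s \<in> {0..<1} \<Longrightarrow> \<bar>V s - \<Phi> k s\<bar> \<le> B"
    "\<And>k s. s \<in> {0..<1} \<Longrightarrow> \<bar>D s - \<Phi>' k s\<bar> \<le> B"
proof -
  have "compact (D ` {0..1})"
    using D by (intro compact_continuous_image) (auto intro: continuous_on_subset)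
  then obtain C where C: "\<And>s. s \<in> {0..1} \<Longrightarrow> \<bar>D s\<bar> \<le> C"
    using compact_imp_bounded bounded_iff by (metis imageI real_norm_def)
  have C0: "0 \<le> C" by (rule order_trans[OF abs_ge_zero C[of 0]]) simp
  have "\<exists>p. real_polynomial_function p \<and> (\<forall>s\<in>{0..1}. \<bar>D s - p s\<bar> < inverse (real (Suc k)))" for k
    by (rule Stone_Weierstrass_real_polynomial_function[of "{0..1}" D "inverse (real (Suc k))"])
      (use D in \<open>auto intro: continuous_on_subset\<close>)
  then obtain p where p: "\<And>k. real_polynomial_function (p k)"
    "\<And>k s. s \<in> {0..1} \<Longrightarrow> \<bar>D s - p k s\<bar> < inverse (real (Suc k))" by metis
  have "\<exists>P. P 1 = 0 \<and> (\<forall>s. (P has_real_derivative p k s) (at s))" for k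
    using antiderivative_vanishing_at_1[OF Ck_imp_continuous[OF Ck_real_polynomial_function[OF p(1)]]]
    by metis
  then obtain P where P: "\<And>k. P k 1 = 0" "\<And>k s. (P k has_real_derivative p k s) (at s)"
    by metis
  have CP: "Ck n (P k)" for n k
    by (rule Ck_Suc_imp_Ck, rule Ck_real_SucI[OF P(2)], rule Ck_real_polynomial_function, rule p(1))
  have inv1: "inverse (real (Suc k)) \<le> 1" for k
    by (rule inverse_le_1_iff[THEN iffD2]) simp
  have pb: "\<bar>p k s\<bar> \<le> C + 1" if "s \<in> {0..1}" for k s
    using p(2)[OF that, of k] C[OF that] inv1[of k] by linarith
  have Pb: "\<bar>P k s\<bar> \<le> (C + 1) * (1 - s)" if "s \<in> {0..1}" for k s
    by (rule vanishing_at_1_bound[OF P pb that])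
  have Vb: "\<bar>V s\<bar> \<le> C * (1 - s)" if "s \<in> {0..1}" for s
    by (rule vanishing_at_1_bound[OF V C that])
  have PVb: "\<bar>V s - P k s\<bar> \<le> inverse (real (Suc k)) * (1 - s)" if "s \<in> {0..1}" for k s
    by (rule vanishing_at_1_bound[of _ "\<lambda>s. D s - p k s"])
      (use V P p(2) that in \<open>auto intro!: derivative_intros less_imp_le\<close>)
  \<comment> \<open>The argument is negative for \<open>s > 1 - 1 / (k + 2)\<close> and tends to infinity for fixed \<open>s < 1\<close>.\<close>
  define \<tau> where "\<tau> k s = (real k + 2) * (1 - s) - 1" for k s
  define \<eta> where "\<eta> k s = flat_exp (\<tau> k s)" for k s
  define \<eta>' where "\<eta>' k s = - (real k + 2) * ((inverse (\<tau> k s))\<^sup>2 * flat_exp (\<tau> k s))" for k s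
  have d\<eta>: "(\<eta> k has_real_derivative \<eta>' k s) (at s)" for k s
  proof -
    have "(\<tau> k has_real_derivative - (real k + 2)) (at s)"
      unfolding \<tau>_def by (auto intro!: derivative_eq_intros)
    from DERIV_chain2[OF flat_exp_has_derivative this] show ?thesis
      unfolding \<eta>_def[abs_def] \<eta>'_def by (simp add: mult.commute)
  qed
  have C\<eta>: "Ck n (\<eta> k)" for n k
  proof -
    have "\<eta> k = (\<lambda>s. flat_exp (- (real k + 2) * s + (real k + 1)))"
      by (simp add: \<eta>_def \<tau>_def fun_eq_iff algebra_simps)
    then show ?thesis using Ck_affine_compose[OF Ck_flat_exp] by simp
  qed
  have \<tau>inf: "filterlim (\<lambda>k. \<tau> k s) at_top sequentially" if "s < 1" for s
    unfolding \<tau>_def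
  proof -
    have "filterlim (\<lambda>k. (1 - s) * real k) at_top sequentially"
      using that by (intro filterlim_tendsto_pos_mult_at_top[OF tendsto_const] filterlim_real_sequentially) auto
    then have "filterlim (\<lambda>k. (2 * (1 - s) - 1) + (1 - s) * real k) at_top sequentially"
      by (rule filterlim_tendsto_add_at_top[OF tendsto_const])
    then show "filterlim (\<lambda>k. (real k + 2) * (1 - s) - 1) at_top sequentially"
      by (simp add: algebra_simps)
  qed
  have \<eta>b: "\<bar>\<eta> k s\<bar> \<le> 1" for k s
    using flat_exp_bounds by (simp add: \<eta>_def)
  have \<eta>lim: "(\<lambda>k. \<eta> k s) \<longlonglongrightarrow> 1" if "s < 1" for s
    unfolding \<eta>_def by (rule filterlim_compose[OF flat_exp_tendsto_1 \<tau>inf[OF that]])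
  \<comment> \<open>Bounds \<open>\<eta>' * P\<close> up to a constant factor, because \<open>P\<close> vanishes linearly at \<open>1\<close>.\<close>
  define \<mu> where "\<mu> k s = \<bar>\<eta>' k s\<bar> * (1 - s)" for k s
  have \<mu>eq: "\<mu> k s = (\<tau> k s + 1) * ((inverse (\<tau> k s))\<^sup>2 * flat_exp (\<tau> k s))" for k s
    using flat_exp_bounds(1)[of "\<tau> k s"]
    by (simp add: \<mu>_def \<eta>'_def abs_mult) (simp add: \<tau>_def)
  have \<mu>b: "\<mu> k s \<le> 2" for k s
    using flat_exp_derivative_bound(1)[of "\<tau> k s"]
    by (cases "\<tau> k s > 0") (simp_all add: \<mu>eq flat_exp_nonpos)
  have \<mu>0: "0 \<le> \<mu> k s" if "s < 1" for k s
    using that by (simp add: \<mu>_def)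
  have \<mu>lim: "(\<lambda>k. \<mu> k s) \<longlonglongrightarrow> 0" if s: "s < 1" for s
  proof (rule tendsto_sandwich[where f = "\<lambda>_. 0" and h = "\<lambda>k. inverse (\<tau> k s) + (inverse (\<tau> k s))\<^sup>2"])
    have "(\<lambda>k. inverse (\<tau> k s)) \<longlonglongrightarrow> 0"
      by (rule tendsto_inverse_0_at_top[OF \<tau>inf[OF s]])
    then have "(\<lambda>k. inverse (\<tau> k s) + (inverse (\<tau> k s))\<^sup>2) \<longlonglongrightarrow> 0 + 0\<^sup>2"
      by (intro tendsto_intros)
    then show "(\<lambda>k. inverse (\<tau> k s) + (inverse (\<tau> k s))\<^sup>2) \<longlonglongrightarrow> 0" by simp
    have "eventually (\<lambda>k. \<tau> k s > 0) sequentially"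
      using \<tau>inf[OF s] by (simp add: filterlim_at_top_dense)
    then show "eventually (\<lambda>k. \<mu> k s \<le> inverse (\<tau> k s) + (inverse (\<tau> k s))\<^sup>2) sequentially"
      by eventually_elim (simp only: \<mu>eq flat_exp_derivative_bound(2))
    show "eventually (\<lambda>k. 0 \<le> \<mu> k s) sequentially" using \<mu>0[OF s] by simp
  qed simp
  define \<Phi> where "\<Phi> k s = \<eta> k s * P k s" for k s
  define \<Phi>' where "\<Phi>' k s = \<eta>' k s * P k s + p k s * \<eta> k s" for k s
  have \<eta>'P: "\<bar>\<eta>' k s * P k s\<bar> \<le> (C + 1) * \<mu> k s" if "s \<in> {0..<1}" for k s
  proof -
    have "\<bar>\<eta>' k s * P k s\<bar> \<le> \<bar>\<eta>' k s\<bar> * ((C + 1) * (1 - s))"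
      unfolding abs_mult using Pb[of s k] that by (intro mult_left_mono) auto
    then show ?thesis by (simp add: \<mu>_def algebra_simps)
  qed
  have pk\<eta>: "\<bar>p k s * \<eta> k s\<bar> \<le> C + 1" if "s \<in> {0..<1}" for k s
  proof -
    have "\<bar>p k s * \<eta> k s\<bar> \<le> (C + 1) * 1"
      unfolding abs_mult using pb[of s k] \<eta>b[of k s] that C0 by (intro mult_mono) auto
    then show ?thesis by simp
  qed
  have limP: "(\<lambda>k. P k s) \<longlonglongrightarrow> V s" if "s \<in> {0..<1}" for s
  proof (rule LIM_zero_cancel, rule Lim_null_comparison)
    show "eventually (\<lambda>k. norm (P k s - V s) \<le> inverse (real (Suc k)) * (1 - s)) sequentially"
      using PVb[of s] that by (auto simp: abs_minus_commute)
    have "(\<lambda>k. inverse (real (Suc k)) * (1 - s)) \<longlonglongrightarrow> 0 * (1 - s)"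
      by (intro tendsto_intros LIMSEQ_inverse_real_of_nat)
    then show "(\<lambda>k. inverse (real (Suc k)) * (1 - s)) \<longlonglongrightarrow> 0" by simp
  qed
  have limp: "(\<lambda>k. p k s) \<longlonglongrightarrow> D s" if "s \<in> {0..<1}" for s
  proof (rule LIM_zero_cancel, rule Lim_null_comparison)
    show "eventually (\<lambda>k. norm (p k s - D s) \<le> inverse (real (Suc k))) sequentially"
      using p(2)[of s] that by (auto simp: abs_minus_commute intro!: always_eventually less_imp_le)
    show "(\<lambda>k. inverse (real (Suc k))) \<longlonglongrightarrow> 0"
      by (rule LIMSEQ_inverse_real_of_nat)
  qed
  show thesis
  proof (rule that[of \<Phi> \<Phi>' "6 * C + 6"])
    fix s k n
    show "Ck n (\<Phi> k)" unfolding \<Phi>_def by (intro Ck_mult C\<eta> CP)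
    show "(\<Phi> k has_real_derivative \<Phi>' k s) (at s)"
      unfolding \<Phi>_def \<Phi>'_def by (rule DERIV_mult[OF d\<eta> P(2)])
    show "\<Phi> k s = 0" if "s > 1 - 1 / (real k + 2)"
    proof -
      have "1 - s < 1 / (real k + 2)" using that by linarith
      then have "\<tau> k s \<le> 0" by (simp add: \<tau>_def field_simps)
      then show ?thesis by (simp add: \<Phi>_def \<eta>_def flat_exp_nonpos)
    qed
    assume s: "s \<in> {0..<1}"
    then have s1: "s < 1" by simp
    have "(\<lambda>k. \<Phi> k s) \<longlonglongrightarrow> 1 * V s"
      unfolding \<Phi>_def by (intro tendsto_intros \<eta>lim limP s s1)
    then show "(\<lambda>k. \<Phi> k s) \<longlonglongrightarrow> V s" by simp
    have "(\<lambda>k. \<eta>' k s * P k s) \<longlonglongrightarrow> 0"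
    proof (rule Lim_null_comparison)
      show "eventually (\<lambda>k. norm (\<eta>' k s * P k s) \<le> (C + 1) * \<mu> k s) sequentially"
        using \<eta>'P[OF s] by simp
      have "(\<lambda>k. (C + 1) * \<mu> k s) \<longlonglongrightarrow> (C + 1) * 0"
        by (intro tendsto_intros \<mu>lim s1)
      then show "(\<lambda>k. (C + 1) * \<mu> k s) \<longlonglongrightarrow> 0" by simp
    qed
    then have "(\<lambda>k. \<Phi>' k s) \<longlonglongrightarrow> 0 + D s * 1"
      unfolding \<Phi>'_def by (intro tendsto_intros \<eta>lim limp s s1)
    then show "(\<lambda>k. \<Phi>' k s) \<longlonglongrightarrow> D s" by simp
    have s01: "s \<in> {0..1}" using s by auto
    have "\<bar>\<Phi> k s\<bar> \<le> 1 * ((C + 1) * (1 - s))"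
      unfolding \<Phi>_def abs_mult using \<eta>b Pb[OF s01] by (intro mult_mono) auto
    also have "\<dots> \<le> 1 * ((C + 1) * 1)"
      using s C0 by (intro mult_left_mono) simp_all
    finally have "\<bar>\<Phi> k s\<bar> \<le> C + 1" by simp
    moreover have "C * (1 - s) \<le> C * 1"
      using s C0 by (intro mult_left_mono) simp_all
    then have "\<bar>V s\<bar> \<le> C" using Vb[OF s01] by simp
    ultimately show "\<bar>V s - \<Phi> k s\<bar> \<le> 6 * C + 6"
      using C0 by linarith
    have "(C + 1) * \<mu> k s \<le> (C + 1) * 2"
      using \<mu>b C0 by (intro mult_left_mono) auto
    from order_trans[OF \<eta>'P[OF s] this] have "\<bar>\<eta>' k s * P k s\<bar> \<le> 2 * C + 2" by simp
    moreover have "\<bar>x - (y + z)\<bar> \<le> \<bar>x\<bar> + \<bar>y\<bar> + \<bar>z\<bar>" for x y z :: real by linarith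
    note this[of "D s" "\<eta>' k s * P k s" "p k s * \<eta> k s"]
    ultimately show "\<bar>D s - \<Phi>' k s\<bar> \<le> 6 * C + 6"
      using pk\<eta>[OF s, of k] C[OF s01] C0 unfolding \<Phi>'_def by linarith
  qed
qed

lemma weak_gradient_C1:
  fixes u :: "'a::euclidean_space \<Rightarrow> real"
  assumes der: "\<And>x. (u has_derivative (\<lambda>h. G x \<bullet> h)) (at x)" and G: "continuous_on UNIV G"
  shows "weak_gradient (ball 0 1) u G"
  unfolding weak_gradient_def
proof (intro allI impI ballI)
  fix \<phi> :: "'a \<Rightarrow> real" and i :: 'a
  assume \<phi>: "test_function (ball 0 1) \<phi>" and i: "i \<in> Basis"
  obtain L where L: "L-lipschitz_on (cball 0 2) u"
    by (rule C1_imp_lipschitz_on_cball[OF der G])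
  have cu: "continuous_on UNIV u"
    using der by (auto intro: has_derivative_continuous simp: continuous_on_eq_continuous_at)
  have "((\<lambda>t. u (x + t *\<^sub>R i)) has_real_derivative G x \<bullet> i) (at 0)" for x
    by (rule directional_derivative[OF der])
  moreover have "(\<lambda>x. G x \<bullet> i) \<in> borel_measurable lebesgue"
  proof -
    have "(\<lambda>x. G x \<bullet> i) \<in> borel_measurable borel"
      by (intro borel_measurable_continuous_onI continuous_intros G)
    then show ?thesis by (intro measurable_completion) simp
  qed
  ultimately show "(LINT x|lebesgue_on (ball 0 1). u x * (gradient \<phi> x \<bullet> i)) =
      - (LINT x|lebesgue_on (ball 0 1). (G x \<bullet> i) * \<phi> x)"
    by (intro integration_by_parts(3)[OF \<phi> i cu L]) auto
qed

text \<open>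
  The boundary condition is \<open>V 1 = 0\<close>. Composing the one-dimensional approximations with \<open>x \<bullet> x\<close> gives
  test functions, and dominated convergence on the unit ball gives convergence in the norm of \<open>H1\<close>.
\<close>

proposition H10_radial:
  fixes D V :: "real \<Rightarrow> real"
  assumes D: "continuous_on UNIV D" and V: "V 1 = 0" "\<And>s. (V has_real_derivative D s) (at s)"
  shows "H10 (ball 0 1) (\<lambda>x::'a::euclidean_space. V (x \<bullet> x)) (\<lambda>x. (2 * D (x \<bullet> x)) *\<^sub>R x)"
proof -
  let ?M = "lebesgue_on (ball (0::'a) 1)"
  have der: "((\<lambda>x::'a. F (x \<bullet> x)) has_derivative (\<lambda>h. ((2 * F' (x \<bullet> x)) *\<^sub>R x) \<bullet> h)) (at x)"
    if "\<And>s. (F has_real_derivative F' s) (at s)" for F F' x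
    using has_derivative_inner_self_compose[OF that, of x] by (simp add: mult_ac)
  have cV: "continuous_on UNIV V"
    using DERIV_continuous_on[of UNIV V D] V(2) by simp
  have cr: "continuous_on UNIV (\<lambda>x::'a. F (x \<bullet> x))" if "continuous_on UNIV F" for F :: "real \<Rightarrow> real"
    by (rule continuous_on_compose2[OF that]) (auto intro!: continuous_intros)
  have cG: "continuous_on UNIV (\<lambda>x::'a. (2 * D (x \<bullet> x)) *\<^sub>R x)"
    by (intro continuous_intros cr[OF D])
  have H1: "H1 (ball 0 1) (\<lambda>x::'a. V (x \<bullet> x)) (\<lambda>x. (2 * D (x \<bullet> x)) *\<^sub>R x)"
    unfolding H1_def
    by (intro conjI square_integrable_continuous weak_gradient_C1 der V cr cV cG)
  obtain \<Phi> \<Phi>' B where \<Phi>: "\<And>n k. Ck n (\<Phi> k)" "\<And>k s. (\<Phi> k has_real_derivative \<Phi>' k s) (at s)"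
    "\<And>k s. s > 1 - 1 / (real k + 2) \<Longrightarrow> \<Phi> k s = 0"
    and lim: "\<And>s. s \<in> {0..<1} \<Longrightarrow> (\<lambda>k. \<Phi> k s) \<longlonglongrightarrow> V s"
    "\<And>s. s \<in> {0..<1} \<Longrightarrow> (\<lambda>k. \<Phi>' k s) \<longlonglongrightarrow> D s"
    and B: "\<And>k s. s \<in> {0..<1} \<Longrightarrow> \<bar>V s - \<Phi> k s\<bar> \<le> B"
    "\<And>k s. s \<in> {0..<1} \<Longrightarrow> \<bar>D s - \<Phi>' k s\<bar> \<le> B"
    using smooth_approximation_vanishing_near_1[OF D V] by blast
  define \<phi> where "\<phi> k x = \<Phi> k (x \<bullet> x)" for k and x :: 'a
  have grad: "gradient (\<phi> k) x = (2 * \<Phi>' k (x \<bullet> x)) *\<^sub>R x" for k x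
    unfolding \<phi>_def by (rule gradientI[OF der[OF \<Phi>(2)]])
  have tf: "test_function (ball 0 1) (\<phi> k)" for k
  proof -
    let ?S = "{x::'a. x \<bullet> x \<le> 1 - 1 / (real k + 2)}"
    have "closed ?S" by (intro closed_Collect_le continuous_intros)
    moreover have "{x. \<phi> k x \<noteq> 0} \<subseteq> ?S"
      using \<Phi>(3)[of k] by (force simp: \<phi>_def not_less[symmetric])
    ultimately have sub: "closure {x. \<phi> k x \<noteq> 0} \<subseteq> ?S" by (intro closure_minimal)
    have S: "?S \<subseteq> ball 0 1"
    proof
      fix x assume "x \<in> ?S"
      moreover have "0 < 1 / (real k + 2)" by simp
      ultimately have "x \<bullet> x < 1" unfolding mem_Collect_eq by linarith
      then have "(norm x)\<^sup>2 < 1\<^sup>2" by (simp add: power2_norm_eq_inner)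
      then have "norm x < 1" by (rule power_less_imp_less_base) simp
      then show "x \<in> ball 0 1" by simp
    qed
    have "bounded (closure {x. \<phi> k x \<noteq> 0})"
      by (rule bounded_subset[OF bounded_ball]) (rule order_trans[OF sub S])
    then have "compact (closure {x. \<phi> k x \<noteq> 0})"
      by (simp add: compact_eq_bounded_closed)
    moreover have "Ck n (\<phi> k)" for n unfolding \<phi>_def by (rule Ck_radial[OF \<Phi>(1)])
    ultimately show ?thesis
      using order_trans[OF sub S] by (simp add: test_function_def)
  qed
  interpret fm: finite_measure ?M by (rule finite_measure_lebesgue_on) simp
  define E where "E k x = (V (x \<bullet> x) - \<phi> k x)\<^sup>2 + (norm ((2 * D (x \<bullet> x)) *\<^sub>R x - gradient (\<phi> k) x))\<^sup>2"
    for k x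
  have Eeq: "E k x = (V (x \<bullet> x) - \<Phi> k (x \<bullet> x))\<^sup>2 + (2 * (D (x \<bullet> x) - \<Phi>' k (x \<bullet> x)))\<^sup>2 * (x \<bullet> x)" for k x
  proof -
    have "(2 * D (x \<bullet> x)) *\<^sub>R x - gradient (\<phi> k) x = (2 * (D (x \<bullet> x) - \<Phi>' k (x \<bullet> x))) *\<^sub>R x"
      by (simp add: grad algebra_simps)
    then show ?thesis
      by (simp add: E_def \<phi>_def power_mult_distrib power2_norm_eq_inner)
  qed
  have in01: "x \<bullet> x \<in> {0..<1}" if "x \<in> ball (0::'a) 1" for x
  proof -
    have "norm x < 1" using that by simp
    then have "(norm x)\<^sup>2 < 1" by (simp add: power_less_one_iff abs_square_less_1)
    then show ?thesis by (simp add: power2_norm_eq_inner)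
  qed
  have "(\<lambda>k. integral\<^sup>L ?M (E k)) \<longlonglongrightarrow> integral\<^sup>L ?M (\<lambda>_. 0)"
  proof (rule integral_dominated_convergence[where w = "\<lambda>_. B\<^sup>2 + (2 * B)\<^sup>2"])
    show "E k \<in> borel_measurable ?M" for k
    proof (rule borel_measurable_integrable[OF integrable_ball_continuous])
      have "continuous_on UNIV (\<phi> k)" "continuous_on UNIV (gradient (\<phi> k))"
        using test_functionD[OF tf] by blast+
      then show "continuous_on UNIV (E k)"
        unfolding E_def by (intro continuous_intros cr cV D)
    qed
    show "AE x in ?M. (\<lambda>k. E k x) \<longlonglongrightarrow> 0"
    proof (rule AE_I2)
      fix x assume "x \<in> space ?M"
      then have x: "x \<bullet> x \<in> {0..<1}" using in01 by simp
      have "(\<lambda>k. E k x) \<longlonglongrightarrow> (V (x \<bullet> x) - V (x \<bullet> x))\<^sup>2 + (2 * (D (x \<bullet> x) - D (x \<bullet> x)))\<^sup>2 * (x \<bullet> x)"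
        unfolding Eeq by (intro tendsto_intros lim x)
      then show "(\<lambda>k. E k x) \<longlonglongrightarrow> 0" by simp
    qed
    show "AE x in ?M. norm (E k x) \<le> B\<^sup>2 + (2 * B)\<^sup>2" for k
    proof (rule AE_I2)
      fix x assume "x \<in> space ?M"
      then have x: "x \<bullet> x \<in> {0..<1}" using in01 by simp
      have "(V (x \<bullet> x) - \<Phi> k (x \<bullet> x))\<^sup>2 \<le> B\<^sup>2"
        using B(1)[OF x, of k] by (metis abs_ge_zero power_mono power2_abs)
      moreover have "(D (x \<bullet> x) - \<Phi>' k (x \<bullet> x))\<^sup>2 \<le> B\<^sup>2"
        using B(2)[OF x, of k] by (metis abs_ge_zero power_mono power2_abs)
      then have "(2 * (D (x \<bullet> x) - \<Phi>' k (x \<bullet> x)))\<^sup>2 * (x \<bullet> x) \<le> (2 * B)\<^sup>2 * 1"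
        unfolding power_mult_distrib[of 2] using x by (intro mult_mono) auto
      moreover have "0 \<le> E k x" unfolding E_def by simp
      ultimately show "norm (E k x) \<le> B\<^sup>2 + (2 * B)\<^sup>2"
        unfolding Eeq by simp
    qed
  qed simp_all
  then have "(\<lambda>k. integral\<^sup>L ?M (E k)) \<longlonglongrightarrow> 0" by simp
  then show ?thesis
    unfolding H10_def E_def using H1 tf by blast
qed

section \<open>Torsion functions of balls and shells\<close>

text \<open>
  With \<open>s = x \<bullet> x\<close>, this is \<open>1 / n\<close> times the fraction of the ball of radius \<open>norm x\<close> that is occupied by
  the centred ball of radius \<open>sqrt b\<close>. The maximum gives a globally Lipschitz function on the real
  line that is constant for \<open>s \<le> b\<close>.
\<close>

definition mean_density :: "real \<Rightarrow> real \<Rightarrow> real \<Rightarrow> real" where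
  "mean_density n b s = (1 / n) * (b / max s b) powr (n / 2)"

text \<open>
  An antiderivative rather than a closed formula, since the latter has a different form in dimension
  \<open>2\<close>. The torsion function of the ball of radius \<open>sqrt b\<close> is this profile at \<open>x \<bullet> x\<close>.
\<close>

definition ball_profile :: "real \<Rightarrow> real \<Rightarrow> real \<Rightarrow> real" where
  "ball_profile n b = (SOME V. V 1 = 0 \<and>
     (\<forall>s. (V has_real_derivative - mean_density n b s / 2) (at s)))"

lemma continuous_mean_density:
  assumes "0 < b" shows "continuous_on UNIV (mean_density n b)"
  unfolding mean_density_def[abs_def] using assms
  by (intro continuous_intros) (auto simp: max_def)

lemma ball_profile:
  assumes "0 < b"
  shows "ball_profile n b 1 = 0"
    "(ball_profile n b has_real_derivative - mean_density n b s / 2) (at s)"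
proof -
  have "continuous_on UNIV (\<lambda>s. - mean_density n b s / 2)"
    by (intro continuous_on_divide continuous_on_minus continuous_on_const
        continuous_mean_density assms) simp
  then obtain V where "V 1 = 0" "\<And>s. (V has_real_derivative - mean_density n b s / 2) (at s)"
    by (rule antiderivative_vanishing_at_1) blast
  then have "V 1 = 0 \<and> (\<forall>s. (V has_real_derivative - mean_density n b s / 2) (at s))" by blast
  then have "ball_profile n b 1 = 0 \<and>
      (\<forall>s. (ball_profile n b has_real_derivative - mean_density n b s / 2) (at s))"
    unfolding ball_profile_def
    by (rule someI[of "\<lambda>V. V 1 = 0 \<and> (\<forall>s. (V has_real_derivative - mean_density n b s / 2) (at s))"])
  then show "ball_profile n b 1 = 0"
    "(ball_profile n b has_real_derivative - mean_density n b s / 2) (at s)" by auto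
qed

text \<open>
  The derivative of the mean density for \<open>s \<noteq> b\<close>. The value at \<open>s = b\<close> only matters on a null set of
  points \<open>x\<close>.
\<close>

definition mean_density' :: "real \<Rightarrow> real \<Rightarrow> real \<Rightarrow> real" where
  "mean_density' n b s = (if s \<le> b then 0 else - (n / 2) / s * mean_density n b s)"

lemma mean_density_inside: "0 < b \<Longrightarrow> s \<le> b \<Longrightarrow> mean_density n b s = 1 / n"
  by (simp add: mean_density_def max_def)

lemma mean_density_outside:
  assumes "0 < b" "b \<le> s"
  shows "mean_density n b s = (1 / n) * (b powr (n / 2) * s powr (- (n / 2)))"
proof -
  have "(b / s) powr (n / 2) = b powr (n / 2) / s powr (n / 2)"
    by (rule powr_divide)
  also have "\<dots> = b powr (n / 2) * s powr (- (n / 2))"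
    by (simp add: powr_minus_divide)
  finally show ?thesis
    using assms by (simp add: mean_density_def max_absorb1)
qed

lemma mean_density_bounds:
  assumes "0 < b" "0 < n" shows "0 \<le> mean_density n b s" "mean_density n b s \<le> 1 / n"
proof -
  have "(b / max s b) powr (n / 2) \<le> 1 powr (n / 2)"
    using assms by (intro powr_mono2) (auto simp: max_def field_simps)
  then show "mean_density n b s \<le> 1 / n"
    using assms by (simp add: mean_density_def divide_right_mono)
  show "0 \<le> mean_density n b s"
    unfolding mean_density_def using assms(2) by (intro mult_nonneg_nonneg) simp_all
qed

lemma power_decay_derivative:
  assumes "0 < b" "0 < s"
  shows "((\<lambda>s. (1 / n) * (b powr (n / 2) * s powr (- (n / 2)))) has_real_derivative
      - (n / 2) / s * ((1 / n) * (b powr (n / 2) * s powr (- (n / 2))))) (at s)"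
proof -
  have "((\<lambda>s. s powr (- (n / 2))) has_real_derivative - (n / 2) * s powr (- (n / 2) - 1)) (at s)"
    by (rule has_real_derivative_powr[OF assms(2)])
  also have "- (n / 2) * s powr (- (n / 2) - 1) = - (n / 2) / s * s powr (- (n / 2))"
    using assms by (simp add: powr_diff)
  finally have d: "((\<lambda>s. s powr (- (n / 2))) has_real_derivative - (n / 2) / s * s powr (- (n / 2))) (at s)" .
  show ?thesis
    by (rule DERIV_cong[OF DERIV_cmult[OF DERIV_cmult[OF d]]]) simp
qed

lemma mean_density_has_derivative:
  assumes "0 < b" "s \<noteq> b"
  shows "(mean_density n b has_real_derivative mean_density' n b s) (at s)"
proof (cases "s < b")
  case True
  have "(mean_density n b has_real_derivative 0) (at s)"
    by (rule has_field_derivative_transform_within_open[OF DERIV_const[of "1 / n"], of "{..<b}"])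
      (use True assms in \<open>auto simp: mean_density_inside\<close>)
  then show ?thesis using True by (simp add: mean_density'_def)
next
  case False
  then have s: "b < s" "0 < s" using assms by auto
  let ?h = "\<lambda>s. (1 / n) * (b powr (n / 2) * s powr (- (n / 2)))"
  have eq: "?h t = mean_density n b t" if "t \<in> {b<..}" for t
    using mean_density_outside[OF assms(1), of t n] that by simp
  have "(mean_density n b has_real_derivative - (n / 2) / s * ?h s) (at s)"
    by (rule has_field_derivative_transform_within_open[where S = "{b<..}",
          OF power_decay_derivative[OF assms(1) s(2)] _ _ eq])
      (use s in auto)
  moreover have "mean_density' n b s = - (n / 2) / s * ?h s"
    using eq[of s] s by (simp add: mean_density'_def)
  ultimately show ?thesis by simp
qed

lemma lipschitz_mean_density:
  assumes b: "0 < b" and n: "0 < n"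
  shows "(1 / (2 * b))-lipschitz_on UNIV (mean_density n b)"
proof -
  let ?h = "\<lambda>s. (1 / n) * (b powr (n / 2) * s powr (- (n / 2)))"
  have "(1 / (2 * b))-lipschitz_on {b..} ?h"
  proof (rule bounded_derivative_imp_lipschitz)
    fix s assume "s \<in> {b..}"
    then have s: "b \<le> s" "0 < s" using b by auto
    show "(?h has_derivative (*) (- (n / 2) / s * ?h s)) (at s within {b..})"
      using power_decay_derivative[OF b s(2), of n]
      by (auto simp: has_field_derivative_def intro: has_derivative_at_withinI)
    have h: "0 \<le> ?h s" "?h s \<le> 1 / n"
      using mean_density_bounds[OF b n, of s] mean_density_outside[OF b s(1), of n] by simp_all
    have "\<bar>- (n / 2) / s * ?h s\<bar> = (n / 2) / s * ?h s"
      using s n h by (simp add: abs_mult)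
    also have "\<dots> \<le> (n / 2) / b * (1 / n)"
      using s b n h by (intro mult_mono divide_left_mono) auto
    also have "\<dots> = 1 / (2 * b)" using n by simp
    finally have bd: "\<bar>- (n / 2) / s * ?h s\<bar> \<le> 1 / (2 * b)" .
    show "onorm ((*) (- (n / 2) / s * ?h s)) \<le> 1 / (2 * b)"
    proof (rule onorm_le)
      fix x :: real
      show "norm (- (n / 2) / s * ?h s * x) \<le> 1 / (2 * b) * norm x"
        unfolding real_norm_def abs_mult[of _ x] by (rule mult_right_mono[OF bd]) simp
    qed
  next
    show "0 \<le> 1 / (2 * b)" using b by simp
  qed (rule convex_real_interval)
  then have h: "\<bar>?h x - ?h y\<bar> \<le> 1 / (2 * b) * \<bar>x - y\<bar>" if "b \<le> x" "b \<le> y" for x y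
    using lipschitz_onD[of "1 / (2 * b)" "{b..}" ?h x y] that by (simp add: dist_real_def)
  have eq: "mean_density n b s = ?h (max s b)" for s
    using mean_density_outside[OF b, of "max s b" n] by (simp add: mean_density_def)
  show ?thesis
  proof (rule lipschitz_onI)
    fix x y :: real
    have "\<bar>mean_density n b x - mean_density n b y\<bar> \<le> 1 / (2 * b) * \<bar>max x b - max y b\<bar>"
      unfolding eq by (rule h) auto
    also have "\<dots> \<le> 1 / (2 * b) * \<bar>x - y\<bar>"
      using b by (intro mult_left_mono) (auto simp: max_def)
    finally show "dist (mean_density n b x) (mean_density n b y) \<le> 1 / (2 * b) * dist x y"
      by (simp add: dist_real_def)
  qed (use b in simp)
qed

lemma AE_norm_neq: "AE x in lebesgue. (x::'a::euclidean_space) \<bullet> x \<noteq> b"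
proof -
  have "negligible (sphere (0::'a) (sqrt b))" by (rule negligible_sphere)
  then have "AE x in lebesgue. x \<notin> sphere (0::'a) (sqrt b)"
    unfolding negligible_iff_null_sets by (rule AE_not_in)
  then show ?thesis
  proof eventually_elim
    case (elim x)
    then show ?case by (auto simp: norm_eq_sqrt_inner)
  qed
qed

lemma AE_lebesgue_on: 
  assumes "AE x in lebesgue. P x" shows "AE x in lebesgue_on (ball a r). P x"
  using assms by (subst AE_restrict_space_iff) (auto elim: eventually_mono)

text \<open>
  The field \<open>W (x \<bullet> x) *\<^sub>R x\<close> has divergence \<open>n * W s + 2 * s * W' s\<close>, which is \<open>1\<close> inside the ball and \<open>0\<close>
  outside, where \<open>W\<close> is a multiple of \<open>s powr (- n / 2)\<close>.
\<close>

lemma mean_density_divergence: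
  fixes \<phi> :: "'a::euclidean_space \<Rightarrow> real"
  assumes \<phi>: "test_function (ball 0 1) \<phi>" and b: "0 < b"
  shows "(LINT x|lebesgue_on (ball 0 1). (mean_density (real DIM('a)) b (x \<bullet> x) *\<^sub>R x) \<bullet> gradient \<phi> x) =
    - (LINT x|lebesgue_on (ball 0 1). indicator {x. x \<bullet> x \<le> b} x * \<phi> x)"
    and "integrable (lebesgue_on (ball 0 1)) (\<lambda>x. (mean_density (real DIM('a)) b (x \<bullet> x) *\<^sub>R x) \<bullet> gradient \<phi> x)"
proof -
  let ?M = "lebesgue_on (ball (0::'a) 1)"
  define n where "n = real DIM('a)"
  have n: "0 < n" by (simp add: n_def)
  let ?W = "mean_density n b" and ?W' = "mean_density' n b"
  define a where "a i x = ?W (x \<bullet> x) * (x \<bullet> i)" for i x :: 'a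
  define a' where "a' i x = ?W (x \<bullet> x) + 2 * (x \<bullet> i)\<^sup>2 * ?W' (x \<bullet> x)" for i x :: 'a
  have cr: "continuous_on UNIV (\<lambda>x::'a. ?W (x \<bullet> x))"
    by (rule continuous_on_compose2[OF continuous_mean_density[OF b]]) (auto intro!: continuous_intros)
  have cW: "?W \<in> borel_measurable borel"
    by (rule borel_measurable_continuous_onI[OF continuous_mean_density[OF b]])
  have mW': "?W' \<in> borel_measurable borel"
    unfolding mean_density'_def[abs_def] using cW by measurable
  have IBP: "integrable ?M (\<lambda>x. a' i x * \<phi> x)" "integrable ?M (\<lambda>x. a i x * (gradient \<phi> x \<bullet> i))"
     "(LINT x|?M. a i x * (gradient \<phi> x \<bullet> i)) = - (LINT x|?M. a' i x * \<phi> x)" if i: "i \<in> Basis" for i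
  proof -
    have ca: "continuous_on UNIV (a i)"
      unfolding a_def by (intro continuous_intros cr)
    obtain L1 where L1: "L1-lipschitz_on (cball 0 2) (\<lambda>x::'a. x \<bullet> x)"
      by (rule C1_imp_lipschitz_on_cball[of "\<lambda>x. x \<bullet> x" "\<lambda>x. 2 *\<^sub>R x"])
        (auto intro!: derivative_eq_intros continuous_intros simp: inner_commute)
    obtain L2 where L2: "L2-lipschitz_on (cball 0 2) (\<lambda>x::'a. x \<bullet> i)"
      by (rule C1_imp_lipschitz_on_cball[of "\<lambda>x. x \<bullet> i" "\<lambda>x. i"])
        (auto intro!: derivative_eq_intros simp: inner_commute)
    have L3: "(1 / (2 * b) * L1)-lipschitz_on (cball 0 2) (\<lambda>x::'a. ?W (x \<bullet> x))"
      by (rule lipschitz_on_compose2[OF L1 lipschitz_on_subset[OF lipschitz_mean_density[OF b n]]]) simp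
    obtain A where A: "0 \<le> A" "\<And>x::'a. x \<in> cball 0 2 \<Longrightarrow> \<bar>?W (x \<bullet> x)\<bar> \<le> A"
      by (rule lipschitz_on_imp_bounded_cball[OF L3]) blast
    obtain B where B: "0 \<le> B" "\<And>x::'a. x \<in> cball 0 2 \<Longrightarrow> \<bar>x \<bullet> i\<bar> \<le> B"
      by (rule lipschitz_on_imp_bounded_cball[OF L2]) blast
    have La: "(A * L2 + B * (1 / (2 * b) * L1))-lipschitz_on (cball 0 2) (a i)"
      unfolding a_def by (rule lipschitz_on_mult_bounded[OF L3 L2 A(2) B(2) A(1) B(1)])
    have ma': "a' i \<in> borel_measurable lebesgue"
    proof -
      have "a' i \<in> borel_measurable borel"
        unfolding a'_def using cW mW' by measurable
      then show ?thesis by (intro measurable_completion) simp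
    qed
    have "AE x in lebesgue. ((\<lambda>t. a i (x + t *\<^sub>R i)) has_real_derivative a' i x) (at 0)"
      using AE_norm_neq[of b]
    proof eventually_elim
      case (elim x)
      have "((\<lambda>x::'a. ?W (x \<bullet> x)) has_derivative (\<lambda>h. ((2 * ?W' (x \<bullet> x)) *\<^sub>R x) \<bullet> h)) (at x)"
        using has_derivative_inner_self_compose[OF mean_density_has_derivative[OF b elim], of n] by (simp add: mult_ac)
      from directional_derivative[OF this, of i]
      have d1: "((\<lambda>t. ?W ((x + t *\<^sub>R i) \<bullet> (x + t *\<^sub>R i))) has_real_derivative 2 * ?W' (x \<bullet> x) * (x \<bullet> i)) (at 0)"
        by simp
      have d2: "((\<lambda>t. (x + t *\<^sub>R i) \<bullet> i) has_real_derivative 1) (at 0)"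
        using i by (auto intro!: derivative_eq_intros simp: inner_add_left)
      show ?case
        unfolding a_def a'_def
        by (rule DERIV_cong[OF DERIV_mult[OF d1 d2]]) (simp add: power2_eq_square algebra_simps)
    qed
    from integration_by_parts[OF \<phi> i ca La this ma']
    show "integrable ?M (\<lambda>x. a' i x * \<phi> x)" "integrable ?M (\<lambda>x. a i x * (gradient \<phi> x \<bullet> i))"
     "(LINT x|?M. a i x * (gradient \<phi> x \<bullet> i)) = - (LINT x|?M. a' i x * \<phi> x)" by auto
  qed
  have lhs: "(?W (x \<bullet> x) *\<^sub>R x) \<bullet> gradient \<phi> x = (\<Sum>i\<in>Basis. a i x * (gradient \<phi> x \<bullet> i))" for x
    unfolding a_def by (subst euclidean_inner) (simp add: mult.assoc)
  have rhs: "(\<Sum>i\<in>Basis. a' i x * \<phi> x) = indicator {x. x \<bullet> x \<le> b} x * \<phi> x" for x :: 'a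
  proof -
    have "(\<Sum>i\<in>Basis. a' i x) = n * ?W (x \<bullet> x) + 2 * (x \<bullet> x) * ?W' (x \<bullet> x)"
      unfolding a'_def n_def
      by (subst (5) euclidean_inner)
         (simp add: sum.distrib sum_distrib_left sum_distrib_right power2_eq_square mult.assoc)
    also have "\<dots> = indicator {x. x \<bullet> x \<le> b} x"
      using n b by (auto simp: mean_density'_def mean_density_inside indicator_def)
    finally show ?thesis by (simp add: sum_distrib_right[symmetric])
  qed
  have "integrable ?M (\<lambda>x. \<Sum>i\<in>Basis. a i x * (gradient \<phi> x \<bullet> i))"
    by (intro Bochner_Integration.integrable_sum IBP)
  then show "integrable ?M (\<lambda>x. (mean_density (real DIM('a)) b (x \<bullet> x) *\<^sub>R x) \<bullet> gradient \<phi> x)"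
    unfolding n_def[symmetric] lhs .
  have "(LINT x|?M. (?W (x \<bullet> x) *\<^sub>R x) \<bullet> gradient \<phi> x) = (\<Sum>i\<in>Basis. LINT x|?M. a i x * (gradient \<phi> x \<bullet> i))"
    unfolding lhs by (rule Bochner_Integration.integral_sum) (rule IBP)
  also have "\<dots> = - (\<Sum>i\<in>Basis. LINT x|?M. a' i x * \<phi> x)"
    by (simp add: IBP sum_negf)
  also have "(\<Sum>i\<in>Basis. LINT x|?M. a' i x * \<phi> x) = (LINT x|?M. (\<Sum>i\<in>Basis. a' i x * \<phi> x))"
    by (rule Bochner_Integration.integral_sum[symmetric]) (rule IBP)
  finally show "(LINT x|?M. (mean_density (real DIM('a)) b (x \<bullet> x) *\<^sub>R x) \<bullet> gradient \<phi> x) =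
      - (LINT x|?M. indicator {x. x \<bullet> x \<le> b} x * \<phi> x)"
    unfolding rhs n_def .
qed

lemma square_integrable_indicator:
  fixes E :: "'a::euclidean_space set"
  assumes "E \<in> sets lebesgue"
  shows "square_integrable (ball a r) (indicator E :: 'a \<Rightarrow> real)"
proof -
  have m: "(indicator E :: 'a \<Rightarrow> real) \<in> borel_measurable (lebesgue_on (ball a r))"
    using assms by (intro measurable_restrict_space1 borel_measurable_indicator) simp
  moreover have "integrable (lebesgue_on (ball a r)) (indicator E :: 'a \<Rightarrow> real)"
    by (rule integrable_ball_bounded[where B = 1, OF m]) (simp add: indicator_def)
  moreover have "(\<lambda>x. (norm (indicat_real E x))\<^sup>2) = indicat_real E"
    by (auto simp: indicator_def)
  ultimately show ?thesis unfolding square_integrable_def by (simp only:)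
qed

text \<open>
  Linearity of the equation is built in here: the three radii may coincide, so that the ball itself
  (\<open>a = b = c\<close>) and the perturbed balls are covered at once.
\<close>

proposition weak_solution_ball_shell:
  fixes E :: "'a::euclidean_space set"
  defines "n \<equiv> real DIM('a)"
  assumes pos: "0 < a" "0 < b" "0 < c" and E: "E \<in> sets lebesgue"
    and ae: "AE x in lebesgue. indicat_real E x =
      indicator {x. x \<bullet> x \<le> a} x + indicator {x. x \<bullet> x \<le> c} x - indicator {x. x \<bullet> x \<le> b} x"
  shows "weak_solution (ball 0 1) (indicator E)
    (\<lambda>x. ball_profile n a (x \<bullet> x) + ball_profile n c (x \<bullet> x) - ball_profile n b (x \<bullet> x))"
proof -
  let ?M = "lebesgue_on (ball (0::'a) 1)"
  let ?V = "\<lambda>s. ball_profile n a s + ball_profile n c s - ball_profile n b s"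
  let ?D = "\<lambda>s. - mean_density n a s / 2 + - mean_density n c s / 2 - - mean_density n b s / 2"
  have H: "H10 (ball 0 1) (\<lambda>x::'a. ?V (x \<bullet> x)) (\<lambda>x. (2 * ?D (x \<bullet> x)) *\<^sub>R x)"
  proof (rule H10_radial)
    show "continuous_on UNIV ?D"
      by (intro continuous_intros continuous_mean_density pos) auto
    show "?V 1 = 0" using pos by (simp add: ball_profile)
    show "(?V has_real_derivative ?D s) (at s)" for s
      by (intro derivative_intros ball_profile(2) pos)
  qed
  show ?thesis
  proof (rule weak_solutionI[OF H square_integrable_indicator[OF E]])
    fix \<phi> :: "'a \<Rightarrow> real" assume \<phi>: "test_function (ball 0 1) \<phi>"
    let ?G = "\<lambda>b x. (mean_density n b (x \<bullet> x) *\<^sub>R x) \<bullet> gradient \<phi> x"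
    let ?I = "\<lambda>b x. indicator {x::'a. x \<bullet> x \<le> b} x * \<phi> x"
    note div = mean_density_divergence[OF \<phi>, folded n_def]
    have sets: "{x::'a. x \<bullet> x \<le> b} \<in> sets lebesgue" for b
    proof -
      have "closed {x::'a. x \<bullet> x \<le> b}" by (intro closed_Collect_le continuous_intros)
      then show ?thesis by (intro sets_completionI_sets) (simp add: borel_closed)
    qed
    have iI: "integrable ?M (?I b)" for b
      using square_integrable_inner[OF square_integrable_indicator[OF sets] square_integrable_test_function(1)[OF \<phi>]]
      by simp
    have "(LINT x|?M. (2 * ?D (x \<bullet> x)) *\<^sub>R x \<bullet> gradient \<phi> x) = (LINT x|?M. ?G b x - ?G a x - ?G c x)"
      by (intro Bochner_Integration.integral_cong) (auto simp: algebra_simps)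
    also have "\<dots> = (LINT x|?M. ?G b x) - (LINT x|?M. ?G a x) - (LINT x|?M. ?G c x)"
      using div(2)[OF pos(1)] div(2)[OF pos(2)] div(2)[OF pos(3)] by simp
    also have "\<dots> = (LINT x|?M. ?I a x) + (LINT x|?M. ?I c x) - (LINT x|?M. ?I b x)"
      unfolding div(1)[OF pos(1)] div(1)[OF pos(2)] div(1)[OF pos(3)] by simp
    also have "\<dots> = (LINT x|?M. ?I a x + ?I c x - ?I b x)"
      using iI by simp
    also have "\<dots> = (LINT x|?M. indicator E x * \<phi> x)"
    proof (rule integral_cong_AE)
      show "(\<lambda>x. ?I a x + ?I c x - ?I b x) \<in> borel_measurable ?M"
        using iI by (intro borel_measurable_integrable) simp
      show "(\<lambda>x. indicator E x * \<phi> x) \<in> borel_measurable ?M"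
        using square_integrable_inner[OF square_integrable_indicator[OF E] square_integrable_test_function(1)[OF \<phi>]]
        by (intro borel_measurable_integrable) simp
      show "AE x in ?M. ?I a x + ?I c x - ?I b x = indicator E x * \<phi> x"
        using AE_lebesgue_on[OF ae] by eventually_elim (simp only: distrib_right left_diff_distrib)
    qed
    finally show "(LINT x|?M. (2 * ?D (x \<bullet> x)) *\<^sub>R x \<bullet> gradient \<phi> x) = (LINT x|?M. indicator E x * \<phi> x)" .
  qed
qed

lemma torsion_eq_weak_solution:
  assumes "weak_solution (ball 0 1) (indicator E) u"
  shows "AE x in lebesgue_on (ball 0 1). torsion E x = u x"
proof -
  have "weak_solution (ball 0 1) (indicator E) (torsion E)"
    unfolding torsion_def
    by (rule someI[of "weak_solution (ball 0 1) (indicator E)", OF assms])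
  then show ?thesis using assms by (rule weak_solution_unique)
qed

text \<open>
  Completeness of Lebesgue measure. It is needed because \<open>j\<close> is only controlled on the half-line, while a
  representative of the torsion function may take negative values on a null set.
\<close>

lemma borel_measurable_lebesgue_on_AE:
  fixes f g :: "'a::euclidean_space \<Rightarrow> real"
  assumes f: "f \<in> borel_measurable (lebesgue_on S)" and S: "S \<in> sets lebesgue"
    and eq: "AE x in lebesgue_on S. g x = f x"
  shows "g \<in> borel_measurable (lebesgue_on S)"
proof -
  obtain N where N: "{x \<in> space (lebesgue_on S). g x \<noteq> f x} \<subseteq> N" "N \<in> null_sets (lebesgue_on S)"
    using eq by (auto simp: eventually_ae_filter)
  have "N \<in> null_sets lebesgue"
    using N(2) S by (simp add: null_sets_restrict_space)
  then have "negligible N" by (simp add: negligible_iff_null_sets)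
  moreover have "f measurable_on S" using f S by (simp add: measurable_on_iff_borel_measurable)
  ultimately have "g measurable_on S"
    by (intro measurable_on_spike[of f S N g]) (use N(1) in auto)
  then show ?thesis using S by (simp add: measurable_on_iff_borel_measurable)
qed

lemma J_functional_eq:
  fixes u :: "'a::euclidean_space \<Rightarrow> real"
  assumes "weak_solution (ball 0 1) (indicator E) u"
    and "continuous_on (ball 0 1) (\<lambda>x. j (u x))"
  shows "J_functional j E = (LINT x|lebesgue_on (ball 0 1). j (u x))"
  unfolding J_functional_def
proof (rule integral_cong_AE)
  have ae: "AE x in lebesgue_on (ball 0 1). j (torsion E x) = j (u x)"
    using torsion_eq_weak_solution[OF assms(1)] by eventually_elim simp
  then show "AE x in lebesgue_on (ball 0 1). j (torsion E x) = j (u x)" .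
  show m: "(\<lambda>x. j (u x)) \<in> borel_measurable (lebesgue_on (ball 0 1))"
    by (rule continuous_imp_measurable_on_sets_lebesgue[OF assms(2)]) simp
  show "(\<lambda>x. j (torsion E x)) \<in> borel_measurable (lebesgue_on (ball 0 1))"
    by (rule borel_measurable_lebesgue_on_AE[OF m _ ae]) simp
qed

section \<open>The deficit of the profiles\<close>

text \<open>
  In the volume variable \<open>y = s powr (n / 2)\<close> the mean density is piecewise linear in the volume fraction
  of the ball, so its second difference is a tent.
\<close>

lemma mean_density_eq_min:
  assumes b: "0 < b" and s: "0 < s" and n: "0 < n"
  shows "mean_density n b s = (1 / n) * (min (s powr (n / 2)) (b powr (n / 2)) / s powr (n / 2))"
proof (cases "s \<le> b")
  case True
  then have "s powr (n / 2) \<le> b powr (n / 2)" using s n by (intro powr_mono2) auto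
  then show ?thesis using True b s by (simp add: mean_density_inside min_absorb1)
next
  case False
  then have "b powr (n / 2) \<le> s powr (n / 2)" using b n by (intro powr_mono2) auto
  then show ?thesis using False b
    by (simp add: mean_density_outside min_absorb2 powr_minus_divide)
qed

lemma mean_density_mono:
  assumes "0 < b" "b \<le> c" "0 < n"
  shows "mean_density n b s \<le> mean_density n c s"
proof (cases "0 < s")
  case True
  have "b powr (n / 2) \<le> c powr (n / 2)" using assms by (intro powr_mono2) auto
  then show ?thesis
    using assms True
    by (simp add: mean_density_eq_min) (intro divide_right_mono, auto)
next
  case False
  then show ?thesis using assms by (simp add: mean_density_inside)
qed

lemma mean_density_pos:
  assumes "0 < b" "0 < n" shows "0 < mean_density n b s"
proof -
  have "0 < b / max s b" using assms by (simp add: max_def)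
  then have "0 < (b / max s b) powr (n / 2)" unfolding powr_gt_zero by linarith
  then show ?thesis unfolding mean_density_def using assms(2) by (intro mult_pos_pos) simp_all
qed

lemma tent_eq:
  fixes y B e :: real
  assumes "0 \<le> e"
  shows "2 * min y B - min y (B - e) - min y (B + e) = max 0 (e - \<bar>y - B\<bar>)"
  using assms by (auto simp: min_def max_def abs_real_def)

lemma powr_diff_bounds:
  fixes q l :: real
  assumes q: "0 < q" and l: "0 < l" "l \<le> 1"
  obtains k K where "0 < k" "0 < K"
    "\<And>x y. l \<le> x \<Longrightarrow> x < y \<Longrightarrow> y \<le> 1 \<Longrightarrow> k * (y - x) \<le> y powr q - x powr q \<and> y powr q - x powr q \<le> K * (y - x)"
proof
  let ?k = "q * min 1 (l powr (q - 1))" and ?K = "q * max 1 (l powr (q - 1))"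
  show "0 < ?k" "0 < ?K" using q l by (auto simp: min_def max_def)
  fix x y assume xy: "l \<le> x" "x < y" "y \<le> 1"
  have "\<exists>z>x. z < y \<and> y powr q - x powr q = (y - x) * (q * z powr (q - 1))"
    by (rule MVT2[OF xy(2)]) (use xy l in \<open>auto intro: has_real_derivative_powr\<close>)
  then obtain z where z: "x < z" "z < y" "y powr q - x powr q = (y - x) * (q * z powr (q - 1))"
    by blast
  have z01: "l \<le> z" "z \<le> 1" "0 < z" using z xy l by auto
  have "min 1 (l powr (q - 1)) \<le> z powr (q - 1) \<and> z powr (q - 1) \<le> max 1 (l powr (q - 1))"
  proof (cases "1 \<le> q")
    case True
    then have "l powr (q - 1) \<le> z powr (q - 1)" "z powr (q - 1) \<le> 1 powr (q - 1)"
      using z01 l by (intro powr_mono2; simp)+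
    then show ?thesis by (simp add: min.coboundedI2 max.coboundedI1)
  next
    case False
    then have "z powr (q - 1) \<le> l powr (q - 1)" "1 powr (q - 1) \<le> z powr (q - 1)"
      using z01 l by (intro powr_mono2'; simp)+
    then show ?thesis by (simp add: min.coboundedI1 max.coboundedI2)
  qed
  then have "?k \<le> q * z powr (q - 1)" "q * z powr (q - 1) \<le> ?K"
    using q by (auto intro!: mult_left_mono)
  then show "?k * (y - x) \<le> y powr q - x powr q \<and> y powr q - x powr q \<le> ?K * (y - x)"
    unfolding z(3) using xy by (auto simp: mult.commute[of "y - x"] intro!: mult_right_mono)
qed

text \<open>
  The profile of the ball minus the profile of the perturbed ball: the latter is the sum of the ball
  profiles for \<open>a\<close> and \<open>c\<close> minus the one for \<open>b\<close>, as the shell is a difference of two balls.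
\<close>

definition profile_deficit :: "real \<Rightarrow> real \<Rightarrow> real \<Rightarrow> real \<Rightarrow> real \<Rightarrow> real" where
  "profile_deficit n a b c s = 2 * ball_profile n b s - ball_profile n a s - ball_profile n c s"

text \<open>
  The derivative of the deficit is \<open>- T\<close> with the tent \<open>T\<close>, supported where \<open>\<bar>y - B\<bar> \<le> e\<close>, and the
  map \<open>r\<close> from \<open>y\<close> back to \<open>s\<close> is bi-Lipschitz on \<open>{B / 2..1}\<close>. The mean value theorem on the whole
  support gives the upper bound, and on its middle half, where the tent has at least half its height, the
  lower bound. The map \<open>r\<close> takes volume fractions to squared radii.
\<close>

lemma profile_deficit_bounds:
  fixes n B :: real
  assumes n: "0 < n" and B: "0 < B" "B < 1"
  defines "r \<equiv> (\<lambda>v. v powr (2 / n))"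
  obtains k K s0 where "0 < k" "0 < K" "0 < s0"
    "\<And>e s. 0 < e \<Longrightarrow> e < B / 2 \<Longrightarrow> e < 1 - B \<Longrightarrow> 0 \<le> s \<Longrightarrow> s \<le> 1 \<Longrightarrow>
      0 \<le> profile_deficit n (r (B - e)) (r B) (r (B + e)) s \<and>
      profile_deficit n (r (B - e)) (r B) (r (B + e)) s \<le> K * e\<^sup>2"
    "\<And>e s. 0 < e \<Longrightarrow> e < B / 2 \<Longrightarrow> e < 1 - B \<Longrightarrow> 0 \<le> s \<Longrightarrow> s \<le> s0 \<Longrightarrow>
      k * e\<^sup>2 \<le> profile_deficit n (r (B - e)) (r B) (r (B + e)) s"
proof -
  have q: "0 < 2 / n" using n by simp
  obtain k K where kK: "0 < k" "0 < K"
    "\<And>x y. B / 2 \<le> x \<Longrightarrow> x < y \<Longrightarrow> y \<le> 1 \<Longrightarrow> k * (y - x) \<le> r y - r x \<and> r y - r x \<le> K * (y - x)"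
    using powr_diff_bounds[OF q, of "B / 2"] B unfolding r_def by auto
  have rinv: "r v powr (n / 2) = v" if "0 < v" for v
    using that n by (simp add: r_def powr_powr)
  have rpos: "0 < r v" if "0 < v" for v using that by (simp add: r_def)
  have rmono: "r v \<le> r w" if "0 < v" "v \<le> w" for v w
    using that n unfolding r_def by (intro powr_mono2) auto
  have r1: "r v < 1" if "0 < v" "v < 1" for v
    using powr_less_mono2[OF q, of v 1] that by (simp add: r_def)
  show thesis
  proof (rule that[of "k / (4 * n)" "2 * K / (n * B)" "r (B / 2)"])
    show "0 < k / (4 * n)" "0 < 2 * K / (n * B)" "0 < r (B / 2)"
      using kK n B rpos by auto
    fix e assume e: "0 < e" "e < B / 2" "e < 1 - B"
    define D where "D = profile_deficit n (r (B - e)) (r B) (r (B + e))"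
    define T where "T s = (2 * mean_density n (r B) s - mean_density n (r (B - e)) s - mean_density n (r (B + e)) s) / 2" for s
    have pos: "0 < r (B - e)" "0 < r B" "0 < r (B + e)" using e B by (auto intro!: rpos)
    have der: "(D has_real_derivative - T s) (at s)" for s
      unfolding D_def profile_deficit_def[abs_def] T_def using pos
      by (auto intro!: derivative_eq_intros ball_profile(2) simp: field_simps)
    have Teq: "T s = (1 / (2 * n)) * (max 0 (e - \<bar>s powr (n / 2) - B\<bar>) / s powr (n / 2))" if s: "0 < s" for s
    proof -
      let ?y = "s powr (n / 2)"
      have "T s = (1 / (2 * n)) * ((2 * min ?y B - min ?y (B - e) - min ?y (B + e)) / ?y)"
      proof -
        have alg: "(2 * ((1 / n) * (u / y)) - (1 / n) * (v / y) - (1 / n) * (w / y)) / 2 =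
            (1 / (2 * n)) * ((2 * u - v - w) / y)" if "0 < y" for u v w y
          using that n by (simp add: field_simps)
        have eqs: "r (B - e) powr (n / 2) = B - e" "r B powr (n / 2) = B" "r (B + e) powr (n / 2) = B + e"
          using e B by (auto intro!: rinv)
        show ?thesis
          unfolding T_def mean_density_eq_min[OF pos(1) s n] mean_density_eq_min[OF pos(2) s n]
            mean_density_eq_min[OF pos(3) s n] eqs
          by (rule alg) (use s in simp)
      qed
      then show ?thesis using tent_eq[of e ?y B] e by simp
    qed
    have T0: "T s = 0" if "s \<le> 0" for s
      unfolding T_def using that pos by (simp add: mean_density_inside)
    have Tnonneg: "0 \<le> T s" for s
      using n T0[of s] Teq[of s] by (cases "0 < s") auto
    have anti: "D y \<le> D x" if "x \<le> y" for x y
      using that by (rule DERIV_nonpos_imp_nonincreasing) (use der Tnonneg in \<open>auto intro!: exI\<close>)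
    have mvt: "\<exists>z. x < z \<and> z < y \<and> D x - D y = (y - x) * T z" if "x < y" for x y
      using MVT2[OF that, of D "\<lambda>z. - T z"] der by (auto simp: algebra_simps)
    have D1: "D 1 = 0" using pos by (simp add: D_def profile_deficit_def ball_profile)
    have far: "T z = 0" if "0 < z" "z \<le> r (B - e) \<or> r (B + e) \<le> z" for z
    proof -
      have "z powr (n / 2) \<le> B - e \<or> B + e \<le> z powr (n / 2)"
        using that(2)
      proof
        assume "z \<le> r (B - e)"
        then have "z powr (n / 2) \<le> r (B - e) powr (n / 2)" using that n by (intro powr_mono2) auto
        then show ?thesis using rinv[of "B - e"] e by simp
      next
        assume "r (B + e) \<le> z"
        then have "r (B + e) powr (n / 2) \<le> z powr (n / 2)" using pos n by (intro powr_mono2) auto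
        then show ?thesis using rinv[of "B + e"] e B by simp
      qed
      then have "max 0 (e - \<bar>z powr (n / 2) - B\<bar>) = 0" by (auto simp: abs_real_def)
      then show ?thesis using Teq[OF that(1)] by simp
    qed
    \<comment> \<open>The deficit is constant before the support of the tent and zero after it.\<close>
    have D0: "D 0 = D (r (B - e))"
      using mvt[OF pos(1)] far by fastforce
    have Dc: "D (r (B + e)) = 0"
      using mvt[OF r1[of "B + e"]] far pos D1 e B by fastforce
    have lt: "B - e < B + e" "B / 2 \<le> B - e" "B + e \<le> 1" using e by auto
    have rlt: "r (B - e) < r (B + e)"
      using powr_less_mono2[OF q, of "B - e" "B + e"] e B by (simp add: r_def)
    obtain z where z: "r (B - e) < z" "D (r (B - e)) - D (r (B + e)) = (r (B + e) - r (B - e)) * T z"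
      using mvt[OF rlt] by blast
    have z0: "0 < z" using z pos by linarith
    have Tz: "T z \<le> e / (n * B)"
    proof -
      have "r (B - e) powr (n / 2) \<le> z powr (n / 2)" using z(1) pos n by (intro powr_mono2) auto
      then have y: "B / 2 \<le> z powr (n / 2)" using rinv[of "B - e"] e by simp
      have "max 0 (e - \<bar>z powr (n / 2) - B\<bar>) / z powr (n / 2) \<le> e / (B / 2)"
        using y e B by (intro frac_le) auto
      then have "T z \<le> (1 / (2 * n)) * (e / (B / 2))"
        unfolding Teq[OF z0] using n by (intro mult_left_mono) auto
      then show ?thesis by (simp add: field_simps)
    qed
    have up: "D 0 \<le> 2 * K / (n * B) * e\<^sup>2"
    proof -
      have "D 0 = (r (B + e) - r (B - e)) * T z" using z Dc D0 by simp
      also have "\<dots> \<le> (K * (2 * e)) * (e / (n * B))"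
        using kK(3)[OF lt(2,1,3)] Tz rlt Tnonneg kK(2) e by (intro mult_mono) auto
      also have "\<dots> = 2 * K / (n * B) * e\<^sup>2" by (simp add: power2_eq_square)
      finally show ?thesis .
    qed
    show "0 \<le> profile_deficit n (r (B - e)) (r B) (r (B + e)) s \<and>
      profile_deficit n (r (B - e)) (r B) (r (B + e)) s \<le> 2 * K / (n * B) * e\<^sup>2" if "0 \<le> s" "s \<le> 1" for s
      using anti[OF that(1)] anti[OF that(2)] up D1 unfolding D_def[symmetric] by linarith
    let ?a = "B - e / 2" and ?c = "B + e / 2"
    have lt2: "?a < ?c" "B / 2 \<le> ?a" "?c \<le> 1" "0 < ?a" "0 < ?c" using e B by auto
    have rlt2: "r ?a < r ?c"
      using powr_less_mono2[OF q, of ?a ?c] lt2 by (simp add: r_def)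
    obtain w where w: "r ?a < w" "w < r ?c" "D (r ?a) - D (r ?c) = (r ?c - r ?a) * T w"
      using mvt[OF rlt2] by blast
    have w0: "0 < w" using w(1) rpos[OF lt2(4)] by linarith
    have Tw: "e / (4 * n) \<le> T w"
    proof -
      have "r ?a powr (n / 2) \<le> w powr (n / 2)" "w powr (n / 2) \<le> r ?c powr (n / 2)"
        using w rpos[OF lt2(4)] w0 n by (auto intro!: powr_mono2)
      then have y: "?a \<le> w powr (n / 2)" "w powr (n / 2) \<le> ?c"
        using rinv lt2 by auto
      have "(e / 2) / 1 \<le> max 0 (e - \<bar>w powr (n / 2) - B\<bar>) / w powr (n / 2)"
        using y lt2 e by (intro frac_le) (auto simp: abs_real_def max_def)
      then have "(1 / (2 * n)) * ((e / 2) / 1) \<le> T w"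
        unfolding Teq[OF w0] using n by (intro mult_left_mono) auto
      then show ?thesis by simp
    qed
    show "k / (4 * n) * e\<^sup>2 \<le> profile_deficit n (r (B - e)) (r B) (r (B + e)) s"
      if "0 \<le> s" "s \<le> r (B / 2)" for s
    proof -
      have "k / (4 * n) * e\<^sup>2 = (k * e) * (e / (4 * n))" by (simp add: power2_eq_square)
      also have "\<dots> \<le> (r ?c - r ?a) * T w"
        using kK(3)[OF lt2(2,1,3)] Tw kK(1) e n rlt2 by (intro mult_mono) auto
      also have "\<dots> = D (r ?a) - D (r ?c)" using w by simp
      also have "\<dots> \<le> D (r ?a)"
        using anti[of "r ?c" 1] D1 rmono[OF lt2(5,3)] by (simp add: r_def)
      also have "\<dots> \<le> D s"
        using that rmono[of "B / 2" ?a] B lt2 by (intro anti) auto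
      finally show ?thesis by (simp add: D_def)
    qed
  qed
qed

section \<open>Slopes of convex functions\<close>

lemma convex_slope_mono:
  fixes f :: "real \<Rightarrow> real"
  assumes f: "convex_on I f" and mem: "x \<in> I" "y \<in> I" "u \<in> I" "v \<in> I"
    and ord: "x < y" "y \<le> u" "u < v"
  shows "(f y - f x) / (y - x) \<le> (f v - f u) / (v - u)"
proof -
  have flip: "(f p - f q) / (p - q) = (f q - f p) / (q - p)" for p q
    by (metis minus_diff_eq minus_divide_divide)
  have "(f y - f x) / (y - x) \<le> (f v - f x) / (v - x)"
    using convex_on_slope_le(1)[OF f mem(1,4), of y] ord by (simp add: flip[of x])
  also have "\<dots> \<le> (f v - f y) / (v - y)"
    using convex_on_slope_le(2)[OF f mem(1,4), of y] ord by (simp add: flip[of _ v])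
  also have "\<dots> \<le> (f v - f u) / (v - u)"
    using convex_on_slope_le(2)[OF f mem(2,4), of u] ord by (cases "y = u") (simp_all add: flip[of _ v])
  finally show ?thesis .
qed

lemma C1_on_halfline_continuous: "C1_on_halfline j \<Longrightarrow> continuous_on {0..} j"
  unfolding C1_on_halfline_def by (auto intro: DERIV_continuous_on)

section \<open>The functional at the ball and at the perturbed balls\<close>

lemma indicator_ball_eq:
  fixes x :: "'a::euclidean_space"
  assumes "x \<bullet> x \<noteq> b"
  shows "norm x < sqrt b \<longleftrightarrow> x \<bullet> x \<le> b" "sqrt b < norm x \<longleftrightarrow> \<not> x \<bullet> x \<le> b"
  using assms by (auto simp: norm_eq_sqrt_inner)

lemma weak_solution_ball:
  fixes b :: real
  assumes "0 < b"
  shows "weak_solution (ball (0::'a::euclidean_space) 1) (indicator (ball 0 (sqrt b)))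
    (\<lambda>x. ball_profile (real DIM('a)) b (x \<bullet> x))"
proof -
  have "AE x in lebesgue. indicat_real (ball (0::'a) (sqrt b)) x = indicator {x. x \<bullet> x \<le> b} x
      + indicator {x. x \<bullet> x \<le> b} x - indicator {x. x \<bullet> x \<le> b} x"
    using AE_norm_neq[of b]
    by eventually_elim (use indicator_ball_eq in \<open>auto simp: indicator_def\<close>)
  from weak_solution_ball_shell[OF assms assms assms _ this] show ?thesis by simp
qed

lemma weak_solution_perturbed_ball:
  fixes a b c :: real
  assumes "0 < a" "a \<le> b" "b \<le> c"
  shows "weak_solution (ball (0::'a::euclidean_space) 1)
    (indicator (ball 0 (sqrt a) \<union> {x. sqrt b < norm x \<and> norm x < sqrt c}))
    (\<lambda>x. ball_profile (real DIM('a)) b (x \<bullet> x) - profile_deficit (real DIM('a)) a b c (x \<bullet> x))"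
proof -
  let ?E = "ball (0::'a) (sqrt a) \<union> {x. sqrt b < norm x \<and> norm x < sqrt c}"
  have "open {x::'a. sqrt b < norm x \<and> norm x < sqrt c}"
    by (intro open_Collect_conj open_Collect_less continuous_intros)
  then have E: "?E \<in> sets lebesgue" by (intro sets_completionI_sets) (simp add: borel_open open_Un)
  have ae: "AE x in lebesgue. indicat_real ?E x =
      indicator {x. x \<bullet> x \<le> a} x + indicator {x. x \<bullet> x \<le> c} x - indicator {x. x \<bullet> x \<le> b} x"
    using AE_norm_neq[of a] AE_norm_neq[of b] AE_norm_neq[of c]
  proof eventually_elim
    case (elim x)
    show ?case
      using indicator_ball_eq[OF elim(1)] indicator_ball_eq[OF elim(2)] indicator_ball_eq[OF elim(3)] assms
      by (auto simp: indicator_def)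
  qed
  have "0 < b" "0 < c" using assms by auto
  from weak_solution_ball_shell[OF assms(1) this E ae] show ?thesis
    by (simp add: profile_deficit_def algebra_simps)
qed

lemma continuous_ball_profile:
  assumes "0 < b" shows "continuous_on UNIV (ball_profile n b)"
  by (rule DERIV_continuous_on[OF ball_profile(2)[OF assms]])

lemma nonneg_if_derivative_nonpos:
  fixes V :: "real \<Rightarrow> real"
  assumes "V 1 = 0" "\<And>s. (V has_real_derivative - W s) (at s)" "\<And>s. 0 \<le> W s" "s \<le> 1"
  shows "0 \<le> V s"
  using DERIV_nonpos_imp_nonincreasing[OF assms(4), of V] assms(1-3) by fastforce

lemma ball_profile_nonneg:
  assumes "0 < b" "0 < n" "s \<le> 1"
  shows "0 \<le> ball_profile n b s"
  by (rule nonneg_if_derivative_nonpos[where W = "\<lambda>s. mean_density n b s / 2"])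
    (use assms ball_profile[OF assms(1)] mean_density_bounds[OF assms(1,2)] in auto)

lemma ball_profile_strict_antimono:
  assumes "0 < b" "0 < n" "s < t"
  shows "ball_profile n b t < ball_profile n b s"
  by (rule DERIV_neg_imp_decreasing[OF assms(3)])
    (use ball_profile(2)[OF assms(1)] mean_density_pos[OF assms(1,2)] in \<open>auto intro!: exI\<close>)

lemma perturbed_profile_nonneg:
  assumes "0 < a" "0 < b" "b \<le> c" "0 < n" "s \<le> 1"
  shows "0 \<le> ball_profile n b s - profile_deficit n a b c s"
proof -
  have c: "0 < c" using assms by linarith
  let ?V = "\<lambda>s. ball_profile n a s + ball_profile n c s - ball_profile n b s"
  have "0 \<le> ?V s"
  proof (rule nonneg_if_derivative_nonpos[where V = ?V and
        W = "\<lambda>s. (mean_density n a s + mean_density n c s - mean_density n b s) / 2"])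
    show "?V 1 = 0" using assms(1,2) c by (simp add: ball_profile)
    show "(?V has_real_derivative - ((mean_density n a s + mean_density n c s - mean_density n b s) / 2)) (at s)" for s
      using assms(1,2) c by (auto intro!: derivative_eq_intros ball_profile(2) simp: field_simps)
    show "0 \<le> (mean_density n a s + mean_density n c s - mean_density n b s) / 2" for s
      using mean_density_mono[OF assms(2,3,4), of s] mean_density_bounds(1)[OF assms(1,4), of s] by simp
  qed (rule assms(5))
  then show ?thesis by (simp add: profile_deficit_def)
qed

lemma continuous_on_radial_compose:
  fixes V j :: "real \<Rightarrow> real"
  assumes j: "continuous_on {0..} j" and V: "continuous_on UNIV V" "\<And>s. s \<le> 1 \<Longrightarrow> 0 \<le> V s"
  shows "continuous_on (cball (0::'a::euclidean_space) 1) (\<lambda>x. j (V (x \<bullet> x)))"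
proof (rule continuous_on_compose2[OF j])
  show "continuous_on (cball (0::'a) 1) (\<lambda>x. V (x \<bullet> x))"
    by (rule continuous_on_compose2[OF V(1)]) (auto intro!: continuous_intros)
  show "(\<lambda>x. V (x \<bullet> x)) ` cball (0::'a) 1 \<subseteq> {0..}"
  proof (rule image_subsetI)
    fix x :: 'a assume "x \<in> cball 0 1"
    then have "(norm x)\<^sup>2 \<le> 1\<^sup>2" by (intro power_mono) auto
    then show "V (x \<bullet> x) \<in> {0..}" using V(2)[of "x \<bullet> x"] by (simp add: power2_norm_eq_inner)
  qed
qed

text \<open>
  Non-negativity of the profile keeps its values in the half-line on which \<open>j\<close> is continuous.
\<close>

lemma J_functional_radial:
  fixes V j :: "real \<Rightarrow> real" and E :: "'a::euclidean_space set"
  assumes j: "continuous_on {0..} j" and V: "continuous_on UNIV V" "\<And>s. s \<le> 1 \<Longrightarrow> 0 \<le> V s"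
    and sol: "weak_solution (ball 0 1) (indicator E) (\<lambda>x. V (x \<bullet> x))"
  shows "J_functional j E = (LINT x|lebesgue_on (ball (0::'a) 1). j (V (x \<bullet> x)))"
    and "integrable (lebesgue_on (ball (0::'a) 1)) (\<lambda>x. j (V (x \<bullet> x)))"
proof -
  note c = continuous_on_radial_compose[OF j V, where 'a = 'a]
  show "integrable (lebesgue_on (ball (0::'a) 1)) (\<lambda>x. j (V (x \<bullet> x)))"
    by (rule integrable_continuous_cball[OF c])
  have "continuous_on (ball (0::'a) 1) (\<lambda>x. j (V (x \<bullet> x)))"
    by (rule continuous_on_subset[OF c]) auto
  then show "J_functional j E = (LINT x|lebesgue_on (ball (0::'a) 1). j (V (x \<bullet> x)))"
    by (rule J_functional_eq[where u = "\<lambda>x. V (x \<bullet> x)" and j = j, OF sol])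
qed

lemma radius_of_volume:
  fixes rs m :: real
  assumes "0 < m" "measure lebesgue (ball (0::'a::euclidean_space) rs) = m"
  shows "rs = (m / unit_ball_volume TYPE('a)) powr (1 / real DIM('a))"
proof -
  let ?n = "real DIM('a)" and ?\<omega> = "unit_ball_volume TYPE('a)"
  have rs: "0 < rs" using assms by (cases "0 < rs") auto
  then have m: "m = rs ^ DIM('a) * ?\<omega>"
    using content_ball_conv_unit_ball[of rs "0::'a"] assms(2) by simp
  then have "?\<omega> \<noteq> 0" using assms(1) by auto
  then have "m / ?\<omega> = rs powr ?n" using m rs by (simp add: powr_realpow)
  then show ?thesis using rs by (simp add: powr_powr)
qed

lemma sqrt_powr_two_over:
  assumes "0 < v" shows "sqrt (v powr (2 / n)) = v powr (1 / n)"
  using assms by (simp add: powr_half_sqrt[symmetric] powr_powr)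

lemma A_set_eq:
  fixes m rs \<delta> :: real
  defines "n \<equiv> real DIM('a::euclidean_space)" and "\<omega> \<equiv> unit_ball_volume TYPE('a)"
  assumes "0 < \<omega>" "0 < m" "rs = (m / \<omega>) powr (1 / n)" "0 < \<delta>" "\<delta> < 2 * m"
  shows "(A_set m rs \<delta> :: 'a set) = ball 0 (sqrt ((m / \<omega> - \<delta> / (2 * \<omega>)) powr (2 / n)))
    \<union> {x. sqrt ((m / \<omega>) powr (2 / n)) < norm x \<and> norm x < sqrt ((m / \<omega> + \<delta> / (2 * \<omega>)) powr (2 / n))}"
proof -
  have v: "m / \<omega> - \<delta> / (2 * \<omega>) = (m - \<delta> / 2) / \<omega>" "m / \<omega> + \<delta> / (2 * \<omega>) = (m + \<delta> / 2) / \<omega>"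
    using assms(3) by (simp_all add: field_simps)
  have "0 < (m - \<delta> / 2) / \<omega>" "0 < (m + \<delta> / 2) / \<omega>" "0 < m / \<omega>"
    using assms by auto
  then show ?thesis
    unfolding v A_set_def Let_def assms(5) n_def[symmetric] \<omega>_def[symmetric]
    by (simp only: sqrt_powr_two_over) (simp only: powr_divide)
qed

text \<open>
  Only values strictly below \<open>M\<close> are available: the maximum of the torsion function is attained at the
  origin alone, so non-constancy almost everywhere is a statement about \<open>{0..<M}\<close>.
\<close>

lemma mono_strict_increase_below:
  fixes j :: "real \<Rightarrow> real"
  assumes "mono_on {0..} j" and "\<not> (\<forall>t\<in>{0..<M}. j t = j 0)"
  obtains p q where "0 \<le> p" "p < q" "q < M" "j p < j q"
proof -
  obtain t where t: "0 \<le> t" "t < M" "j t \<noteq> j 0" using assms(2) by auto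
  moreover have "j 0 \<le> j t" using t assms(1) by (auto intro: mono_onD)
  ultimately show ?thesis using that[of 0 t] by (cases "t = 0") auto
qed

theorem proposition2p14:
  fixes j :: "real \<Rightarrow> real" and m rs :: real
  assumes "0 < m" and "m < unit_ball_volume TYPE('a::euclidean_space)"
    and "measure lebesgue (ball (0::'a) rs) = m"
    and "C1_on_halfline j"
    and "mono_on {0..} j"
    and "convex_on {0..} j"
    and "\<not> j constant_on {0..}"
    and "nonconstant_along j (ball (0::'a) rs)"
  shows "\<exists>\<delta>0 C. 0 < \<delta>0 \<and> \<delta>0 \<le> min (2 * m) (2 * (unit_ball_volume TYPE('a) - m)) \<and> 0 < C \<and>
           (\<forall>\<delta>. 0 < \<delta> \<and> \<delta> < \<delta>0 \<longrightarrow>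
              (1 / C) * \<delta>\<^sup>2 \<le> J_functional j (ball (0::'a) rs) - J_functional j (A_set m rs \<delta> :: 'a set) \<and>
              J_functional j (ball (0::'a) rs) - J_functional j (A_set m rs \<delta> :: 'a set) \<le> C * \<delta>\<^sup>2)"
proof -
  let ?L = "lebesgue_on (ball (0::'a) 1)"
  define n where "n = real DIM('a)"
  define \<omega> where "\<omega> = unit_ball_volume TYPE('a)"
  define B where "B = m / \<omega>"
  define r where "r = (\<lambda>v::real. v powr (2 / n))"
  define V where "V = ball_profile n (r B)"
  define M where "M = V 0"
  have n: "0 < n" by (simp add: n_def)
  have m\<omega>: "m < \<omega>" using assms(2) by (simp add: \<omega>_def)
  have \<omega>: "0 < \<omega>" using assms(1) m\<omega> by linarith
  have B: "0 < B" "B < 1" using assms(1) \<omega> m\<omega> by (simp_all add: B_def)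
  have rB: "0 < r B" using B by (simp add: r_def)
  have rs: "rs = B powr (1 / n)"
    using radius_of_volume[OF assms(1,3)] by (simp add: B_def \<omega>_def n_def)
  then have rs': "rs = sqrt (r B)"
    using sqrt_powr_two_over[OF B(1)] by (simp add: r_def)
  have j: "continuous_on {0..} j" using assms(4) by (rule C1_on_halfline_continuous)
  have V: "continuous_on UNIV V" "\<And>s. s \<le> 1 \<Longrightarrow> 0 \<le> V s" "\<And>s t. s < t \<Longrightarrow> V t < V s"
    unfolding V_def by (rule continuous_ball_profile[OF rB] ball_profile_nonneg[OF rB n]
        ball_profile_strict_antimono[OF rB n]; assumption?)+
  have solB: "weak_solution (ball 0 1) (indicator (ball (0::'a) rs)) (\<lambda>x. V (x \<bullet> x))"
    unfolding V_def rs' n_def by (rule weak_solution_ball[OF rB])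
  have in01: "0 \<le> x \<bullet> x \<and> x \<bullet> x \<le> 1" if "x \<in> ball (0::'a) 1" for x
  proof -
    have "(norm x)\<^sup>2 \<le> 1\<^sup>2" using that by (intro power_mono) auto
    then show ?thesis by (simp add: power2_norm_eq_inner)
  qed

  have "\<not> (\<forall>t\<in>{0..<M}. j t = j 0)"
  proof
    assume c: "\<forall>t\<in>{0..<M}. j t = j 0"
    have "AE x in ?L. (x::'a) \<bullet> x \<noteq> 0 \<and> x \<in> ball 0 1"
      using AE_lebesgue_on[OF AE_norm_neq[of 0]] AE_space[of ?L] by eventually_elim simp
    then have "AE x in ?L. j (torsion (ball (0::'a) rs) x) = j 0"
      using torsion_eq_weak_solution[OF solB]
    proof eventually_elim
      case (elim x)
      then have "0 < x \<bullet> x" "x \<bullet> x \<le> 1" using in01[of x] by auto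
      then have "V (x \<bullet> x) \<in> {0..<M}" using V(2)[of "x \<bullet> x"] V(3)[of 0 "x \<bullet> x"] by (auto simp: M_def)
      then have "j (V (x \<bullet> x)) = j 0" by (rule bspec[OF c])
      then show ?case using elim by simp
    qed
    then have "\<exists>c. AE x in ?L. j (torsion (ball (0::'a) rs) x) = c" by (rule exI[of _ "j 0"])
    then show False using assms(8) unfolding nonconstant_along_def by (rule notE[rotated])
  qed
  from mono_strict_increase_below[OF assms(5) this]
  obtain p t0 where p: "0 \<le> p" "p < t0" "t0 < M" "j p < j t0" .
  \<comment> \<open>Beyond \<open>t0\<close> all slopes of \<open>j\<close> are at least \<open>\<kappa>\<close>, by convexity.\<close>
  define \<kappa> where "\<kappa> = (j t0 - j p) / (t0 - p)"
  have \<kappa>: "0 < \<kappa>" using p by (simp add: \<kappa>_def)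
  have slope_low: "\<kappa> * (x - y) \<le> j x - j y" if "t0 \<le> y" "y < x" for x y
  proof -
    have "\<kappa> \<le> (j x - j y) / (x - y)"
      unfolding \<kappa>_def by (rule convex_slope_mono[OF assms(6)]) (use that p in auto)
    then show ?thesis using that by (simp add: field_simps)
  qed
  \<comment> \<open>The slope of \<open>j\<close> right of the range of \<open>V\<close> bounds its slopes on the range.\<close>
  define S where "S = j (M + 1) - j M"
  have M0: "0 \<le> M" using V(2)[of 0] by (simp add: M_def)
  have S0: "0 \<le> S" unfolding S_def using mono_onD[OF assms(5), of M "M + 1"] M0 by simp
  have slope_up: "j x - j y \<le> S * (x - y)" if "0 \<le> y" "y \<le> x" "x \<le> M" for x y
  proof (cases "y < x")
    case True
    have "(j x - j y) / (x - y) \<le> (j (M + 1) - j M) / (M + 1 - M)"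
      by (rule convex_slope_mono[OF assms(6)]) (use that True in auto)
    then show ?thesis using True by (simp add: S_def field_simps)
  qed (use that in simp)

  obtain k K s0 where kK: "0 < k" "0 < K" "0 < s0"
    and Dup: "\<And>e s. 0 < e \<Longrightarrow> e < B / 2 \<Longrightarrow> e < 1 - B \<Longrightarrow> 0 \<le> s \<Longrightarrow> s \<le> 1 \<Longrightarrow>
      0 \<le> profile_deficit n (r (B - e)) (r B) (r (B + e)) s \<and>
      profile_deficit n (r (B - e)) (r B) (r (B + e)) s \<le> K * e\<^sup>2"
    and Dlow: "\<And>e s. 0 < e \<Longrightarrow> e < B / 2 \<Longrightarrow> e < 1 - B \<Longrightarrow> 0 \<le> s \<Longrightarrow> s \<le> s0 \<Longrightarrow>
      k * e\<^sup>2 \<le> profile_deficit n (r (B - e)) (r B) (r (B + e)) s"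
    using profile_deficit_bounds[OF n B] unfolding r_def by metis

  have "isCont V 0" using V(1) by (simp add: continuous_on_eq_continuous_at)
  then have "\<And>\<epsilon>. 0 < \<epsilon> \<Longrightarrow> \<exists>\<sigma>>0. \<forall>s. \<bar>s\<bar> < \<sigma> \<longrightarrow> \<bar>V s - M\<bar> < \<epsilon>"
    unfolding M_def continuous_at_eps_delta by (simp add: dist_real_def)
  moreover have "0 < (M - t0) / 2" using p by simp
  ultimately obtain \<sigma> where \<sigma>: "0 < \<sigma>" "\<And>s. \<bar>s\<bar> < \<sigma> \<Longrightarrow> \<bar>V s - M\<bar> < (M - t0) / 2"
    by blast
  \<comment> \<open>On the ball of radius \<open>\<rho>\<close> the deficit is of order \<open>e\<^sup>2\<close> and \<open>V\<close> exceeds the midpoint of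
    \<open>t0\<close> and \<open>M\<close>.\<close>
  define \<rho> where "\<rho> = sqrt (min 1 (min s0 \<sigma>) / 2)"
  have \<rho>2: "\<rho>\<^sup>2 = min 1 (min s0 \<sigma>) / 2" using kK \<sigma> by (simp add: \<rho>_def)
  have \<rho>: "0 < \<rho>" "\<rho> < 1" "\<rho>\<^sup>2 \<le> s0" "\<rho>\<^sup>2 < \<sigma>"
  proof -
    show "0 < \<rho>" using kK \<sigma> by (simp add: \<rho>_def)
    have "\<rho>\<^sup>2 < 1\<^sup>2" unfolding \<rho>2 by (simp add: min_def)
    then show "\<rho> < 1" by (rule power_less_imp_less_base) simp
    show "\<rho>\<^sup>2 \<le> s0" "\<rho>\<^sup>2 < \<sigma>" unfolding \<rho>2 using kK \<sigma> by (auto simp: min_def)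
  qed
  define \<beta> where "\<beta> = measure lebesgue (ball (0::'a) \<rho>)"
  have \<beta>: "0 < \<beta>" using content_ball_pos[OF \<rho>(1), of "0::'a"] by (simp add: \<beta>_def)

  \<comment> \<open>The integrand of the difference is at least \<open>\<kappa> * k * e\<^sup>2\<close> on the ball of radius \<open>\<rho>\<close> and at most
    \<open>S * K * e\<^sup>2\<close> on the unit ball; the factor \<open>4 * \<omega>\<^sup>2\<close> comes from \<open>\<delta> = 2 * \<omega> * e\<close>.\<close>
  define c1 where "c1 = \<kappa> * k * \<beta> / (4 * \<omega>\<^sup>2)"
  define c2 where "c2 = S * K * \<omega> / (4 * \<omega>\<^sup>2)"
  have c1: "0 < c1" using \<kappa> kK \<beta> \<omega> by (simp add: c1_def)
  have c2: "0 \<le> c2" using S0 kK \<omega> by (simp add: c2_def)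
  \<comment> \<open>The last entry ensures that the torsion function of the perturbed ball is still at least \<open>t0\<close>
    on the ball of radius \<open>\<rho>\<close>.\<close>
  define e0 where "e0 = min (min (B / 2) (1 - B)) (min 1 ((M - t0) / (2 * K)))"
  have e0: "0 < e0" using B p kK by (simp add: e0_def)

  have main: "c1 * \<delta>\<^sup>2 \<le> J_functional j (ball (0::'a) rs) - J_functional j (A_set m rs \<delta> :: 'a set) \<and>
      J_functional j (ball (0::'a) rs) - J_functional j (A_set m rs \<delta> :: 'a set) \<le> c2 * \<delta>\<^sup>2"
    if \<delta>: "0 < \<delta>" "\<delta> < 2 * \<omega> * e0" for \<delta>
  proof -
    define e where "e = \<delta> / (2 * \<omega>)"
    have "e < e0" using \<delta> \<omega> by (simp add: e_def field_simps)
    then have e: "0 < e" "e < B / 2" "e < 1 - B" "e < 1" "e < (M - t0) / (2 * K)"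
      using \<delta> \<omega> by (auto simp: e_def e0_def)
    define D where "D = profile_deficit n (r (B - e)) (r B) (r (B + e))"
    have D: "0 \<le> D s \<and> D s \<le> K * e\<^sup>2" if "0 \<le> s" "s \<le> 1" for s
      unfolding D_def by (rule Dup[OF e(1-3) that])
    have D0: "k * e\<^sup>2 \<le> D s" if "0 \<le> s" "s \<le> s0" for s
      unfolding D_def by (rule Dlow[OF e(1-3) that])
    have rpos: "0 < r (B - e)" "r (B - e) \<le> r B" "r B \<le> r (B + e)" "0 < r (B + e)"
      using e B n by (auto simp: r_def intro!: powr_mono2)
    have "\<delta> < 2 * m"
    proof -
      have "\<delta> = 2 * \<omega> * e" using \<omega> by (simp add: e_def)
      also have "\<dots> < 2 * \<omega> * (B / 2)" using e \<omega> by simp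
      also have "\<dots> = m" using \<omega> by (simp add: B_def)
      finally show ?thesis using assms(1) by simp
    qed
    then have A: "(A_set m rs \<delta> :: 'a set) = ball 0 (sqrt (r (B - e))) \<union>
        {x. sqrt (r B) < norm x \<and> norm x < sqrt (r (B + e))}"
      using A_set_eq[of m rs \<delta>, where 'a = 'a] \<omega> assms(1) rs \<delta>(1)
      by (simp add: \<omega>_def n_def B_def e_def r_def)
    have solA: "weak_solution (ball 0 1) (indicator (A_set m rs \<delta> :: 'a set)) (\<lambda>x. V (x \<bullet> x) - D (x \<bullet> x))"
      unfolding A V_def D_def n_def by (rule weak_solution_perturbed_ball[OF rpos(1,2,3)])
    have cVD: "continuous_on UNIV (\<lambda>s. V s - D s)"
      unfolding D_def profile_deficit_def
      by (intro continuous_intros V(1) continuous_ball_profile rpos rB)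
    have VD0: "0 \<le> V s - D s" if "s \<le> 1" for s
      unfolding V_def D_def by (rule perturbed_profile_nonneg[OF rpos(1) rB rpos(3) n that])
    have JB: "J_functional j (ball (0::'a) rs) = (LINT x|?L. j (V (x \<bullet> x)))"
        "integrable ?L (\<lambda>x. j (V (x \<bullet> x)))"
      by (rule J_functional_radial[OF j V(1) _ solB]; fact V(2))+
    have JA: "J_functional j (A_set m rs \<delta> :: 'a set) = (LINT x|?L. j (V (x \<bullet> x) - D (x \<bullet> x)))"
        "integrable ?L (\<lambda>x. j (V (x \<bullet> x) - D (x \<bullet> x)))"
      by (rule J_functional_radial[OF j cVD _ solA]; fact VD0)+
    let ?d = "\<lambda>x::'a. j (V (x \<bullet> x)) - j (V (x \<bullet> x) - D (x \<bullet> x))"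
    have diff: "J_functional j (ball (0::'a) rs) - J_functional j (A_set m rs \<delta> :: 'a set) = integral\<^sup>L ?L ?d"
      unfolding JB(1) JA(1) using JB(2) JA(2) by simp
    have int: "integrable ?L ?d" using JB(2) JA(2) by simp
    interpret fm: finite_measure ?L by (rule finite_measure_lebesgue_on) simp

    have "integral\<^sup>L ?L ?d \<le> (LINT x|?L. S * (K * e\<^sup>2))"
    proof (rule integral_mono[OF int])
      fix x assume "x \<in> space ?L"
      then have x: "0 \<le> x \<bullet> x" "x \<bullet> x \<le> 1" using in01[of x] by auto
      have "V (x \<bullet> x) \<le> M" using V(3)[of 0 "x \<bullet> x"] x by (cases "x \<bullet> x = 0") (auto simp: M_def)
      then have "?d x \<le> S * (V (x \<bullet> x) - (V (x \<bullet> x) - D (x \<bullet> x)))"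
        using D[OF x] VD0[OF x(2)] by (intro slope_up) auto
      also have "\<dots> \<le> S * (K * e\<^sup>2)" using D[OF x] S0 by (intro mult_left_mono) auto
      finally show "?d x \<le> S * (K * e\<^sup>2)" .
    qed simp
    also have "\<dots> = S * (K * e\<^sup>2) * \<omega>"
      by (simp add: \<omega>_def measure_restrict_space)
    also have "\<dots> = c2 * \<delta>\<^sup>2"
      using \<omega> by (simp add: c2_def e_def power_divide power_mult_distrib)
    finally have upper: "integral\<^sup>L ?L ?d \<le> c2 * \<delta>\<^sup>2" .

    have "K * e\<^sup>2 \<le> (M - t0) / 2"
    proof -
      have "e\<^sup>2 \<le> e * 1" unfolding power2_eq_square using e by (intro mult_left_mono) auto
      then have "K * e\<^sup>2 \<le> K * ((M - t0) / (2 * K))" using e kK by (intro mult_left_mono) auto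
      then show ?thesis using kK by simp
    qed
    note small = this
    have iind: "integrable ?L (\<lambda>x. \<kappa> * (k * e\<^sup>2) * indicator (ball 0 \<rho>) x)"
      by (intro integrable_mult_right integrable_ball_bounded[where B = 1]
          measurable_restrict_space1 borel_measurable_indicator) (auto simp: indicator_def)
    have sub: "ball (0::'a) \<rho> \<subseteq> ball 0 1" using \<rho> by auto
    have "c1 * \<delta>\<^sup>2 = \<kappa> * (k * e\<^sup>2) * \<beta>"
      using \<omega> by (simp add: c1_def e_def power_divide power_mult_distrib)
    also have "\<dots> = (LINT x|?L. \<kappa> * (k * e\<^sup>2) * indicator (ball 0 \<rho>) x)"
      using sub by (simp add: \<beta>_def measure_restrict_space Int_absorb2 Int_absorb1)
    also have "\<dots> \<le> integral\<^sup>L ?L ?d"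
    proof (rule integral_mono[OF iind int])
      fix x assume "x \<in> space ?L"
      then have x: "0 \<le> x \<bullet> x" "x \<bullet> x \<le> 1" using in01[of x] by auto
      show "\<kappa> * (k * e\<^sup>2) * indicator (ball 0 \<rho>) x \<le> ?d x"
      proof (cases "x \<in> ball 0 \<rho>")
        case True
        then have "(norm x)\<^sup>2 \<le> \<rho>\<^sup>2" by (intro power_mono) auto
        then have s: "x \<bullet> x \<le> s0" "\<bar>x \<bullet> x\<bar> < \<sigma>" using \<rho> x by (auto simp: power2_norm_eq_inner)
        have "(M + t0) / 2 \<le> V (x \<bullet> x)" using \<sigma>(2)[OF s(2)] by (simp add: abs_real_def field_simps split: if_splits)
        then have t: "t0 \<le> V (x \<bullet> x) - D (x \<bullet> x)" using D[OF x] small by (simp add: field_simps)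
        have "0 < k * e\<^sup>2" using kK e by simp
        then have pos: "0 < D (x \<bullet> x)" using D0[OF x(1) s(1)] by linarith
        have "\<kappa> * (k * e\<^sup>2) \<le> \<kappa> * (V (x \<bullet> x) - (V (x \<bullet> x) - D (x \<bullet> x)))"
          using D0[OF x(1) s(1)] \<kappa> by (intro mult_left_mono) auto
        also have "\<dots> \<le> ?d x" using pos by (intro slope_low t) auto
        finally show ?thesis using True by simp
      next
        case False
        have "j (V (x \<bullet> x) - D (x \<bullet> x)) \<le> j (V (x \<bullet> x))"
          using D[OF x] VD0[OF x(2)] by (intro mono_onD[OF assms(5)]) auto
        then show ?thesis using False by simp
      qed
    qed
    finally show ?thesis using upper unfolding diff by simp
  qed

  define C where "C = 1 / c1 + c2"
  have C: "0 < C" "1 / C \<le> c1" "c2 \<le> C"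
  proof -
    have i: "0 < 1 / c1" using c1 by simp
    show pos: "0 < C" unfolding C_def by (rule add_pos_nonneg[OF i c2])
    show "c2 \<le> C" unfolding C_def using i by linarith
    have "1 / c1 \<le> C" unfolding C_def using c2 by linarith
    then have "1 / C \<le> 1 / (1 / c1)" using i pos by (intro divide_left_mono mult_pos_pos) auto
    then show "1 / C \<le> c1" by simp
  qed
  have "0 < 2 * \<omega> * e0" using \<omega> e0 by simp
  moreover have "2 * \<omega> * e0 \<le> min (2 * m) (2 * (\<omega> - m))"
  proof -
    have "e0 \<le> B / 2" "e0 \<le> 1 - B" unfolding e0_def by linarith+
    then have "2 * \<omega> * e0 \<le> 2 * \<omega> * (B / 2)" "2 * \<omega> * e0 \<le> 2 * \<omega> * (1 - B)"
      using \<omega> by (intro mult_left_mono; simp)+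
    moreover have "2 * \<omega> * (B / 2) = m" "2 * \<omega> * (1 - B) = 2 * (\<omega> - m)"
      using \<omega> by (auto simp: B_def field_simps)
    ultimately show ?thesis using assms(1) by simp
  qed
  moreover have "(1 / C) * \<delta>\<^sup>2 \<le> c1 * \<delta>\<^sup>2" "c2 * \<delta>\<^sup>2 \<le> C * \<delta>\<^sup>2" for \<delta> :: real
    by (rule mult_right_mono[OF C(2) zero_le_power2] mult_right_mono[OF C(3) zero_le_power2])+
  ultimately show ?thesis
    using C(1) main unfolding \<omega>_def[symmetric] by (meson order_trans)
qed

end
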